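(* The interpretation $\llbracket - \rrbracket$ of the dependent type theory with context constants $\Delta_n$ and substitution constants $d^n_i$ (specified in the context) in the category of simplicial schemas and display maps, relational instances and full tuples, is sound. That is, every equality rule (E1)--(E20) listed in the context holds true in the interpretation: for every interpretation of the data in the premises of the rule (contexts as schemas, types as instances, terms as full tuples, substitutions as display morphisms), the interpretations of the two sides of the equality judgement in its conclusion are equal.
   Context: **Schemas.** All posets are finite. A subset $B$ of a poset $P$ is a *basis* if, writing $B_{\leq x}=\{z\in B : z\leq x\}$: (a) for all $x,y\in P$, $x\leq y$ iff $B_{\leq x}\subseteq B_{\leq y}$; (b) no two distinct elements of $B$ are comparable; (c) $B_{\leq x}\neq\emptyset$ for all $x\in P$. A basis is unique if it exists; $P$ is then called *based*. A based poset $P$ with basis $B$ is a *simplicial complex* if for all $x\in P$ and nonempty $Y\subseteq B_{\leq x}$ there is $y\in P$ with $B_{\leq y}=Y$. A *(simplicial) schema* is a poset $X$ such that $X^{\mathrm{op}}$ is a simplicial complex. The symbol $\leq$ always denotes the order of the complex $X^{\mathrm{op}}$, and $X$ is regarded as a category with exactly one arrow $\delta^x_y:x\to y$ if $y\leq x$ and none otherwise. $B_{\leq x}$ is the set of basis elements ("attributes") below $x$ in the complex, and $X_n=\{x : |B_{\leq x}|=n+1\}$, so $X_0$ is the basis. A *morphism of schemas* $f:X\to Y$ is an order-preserving map $X^{\mathrm{op}}\to Y^{\mathrm{op}}$ with $f(B_{\leq x})=B_{\leq f(x)}$ for all $x$; these form the category $\mathbb{S}$. A morphism $f$ is *display* if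 $f(X_n)\subseteq Y_n$ for all $n$; then $f$ restricts to bijections $B_{\leq x}\to B_{\leq f(x)}$. $\Delta_n$ is the schema given by the complex of all nonempty subsets of $\{0,\dots,n\}$; $d^n_i:\Delta_n\to\Delta_{n+1}$ ($0\le i\le n+1$) is the morphism determined on attributes by $k\mapsto k$ if $k<i$ and $k\mapsto k+1$ otherwise. **Instances and full tuples.** A *(relational) instance* of $X$ is a functor $I:X\to\mathbf{FinSet}$ such that for every $x\in X$ the functions $I(\delta^x_A)$, $A\in B_{\leq x}$, are jointly injective. $\mathrm{Rel}(X)$ denotes the category of instances of $X$. $1_X$ is the instance $x\mapsto\{x\}$. A *full tuple* of $I$ is a natural transformation $t:1_X\Rightarrow I$, i.e. a choice of $t(x)\in I(x)$ for each $x$ with $I(\delta^x_y)(t(x))=t(y)$; $\mathrm{Trm}_X(I)$ is the set of these. The category of elements $\int_X I$ has objects $\langle x,a\rangle$ with $a\in I(x)$, and an arrow $\langle x,a\rangle\to\langle y,b\rangle$, written $\delta^{x,a}_{y,b}$, for each $\delta^x_y$ with $I(\delta^x_y)(a)=b$; it is a schema, and $p=p_I:\int_XI\to X$, $\langle x,a\rangle\mapsto x$, is display. **Tuple form.** All instances are taken on *tuple form*: $J(x)\subseteq\prod_{A\in B_{\leq x}}J(A)$ with $J(\delta^x_A)$ the projections, singleton tuples being identified with their elements. Every instance is canonically isomorphic, by $k\mapsto (J(\delta^x_A)(k))_{A\in B_{\leq x}}$, to one on tuple form, its *tuplification*. Constructions below that are not literally on tuple form are replaced by their tuplifications, the associated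 full tuples being transported along the canonical isomorphism. For $f:X\to Y$ display, tuples indexed by $B_{\leq f(x)}$ are identified with tuples indexed by $B_{\leq x}$ by reindexing along the bijection $f:B_{\leq x}\to B_{\leq f(x)}$. **Operations.** For $f:X\to Y$, $J\in\mathrm{Rel}(Y)$, $t\in\mathrm{Trm}_Y(J)$: $J[f]=J\circ f\in\mathrm{Rel}(X)$; $t[f]\in\mathrm{Trm}_X(J[f])$ is $x\mapsto t(f(x))$; $\hat t:Y\to\int_YJ$ is $y\mapsto\langle y,t(y)\rangle$; $v=v_J\in\mathrm{Trm}_{\int_YJ}(J[p_J])$ is $\langle y,a\rangle\mapsto a$; $\tilde f:\int_XJ[f]\to\int_YJ$ is $\langle x,a\rangle\mapsto\langle f(x),a\rangle$. For $J\in\mathrm{Rel}(X)$ and $G\in\mathrm{Rel}(\int_XJ)$: - $\Pi_JG$ is the tuplification of $\Xi_JG$, where, with $P_x=\{\langle y,a\rangle : y\leq x,\ a\in J(y)\}$, $\Xi_JG(x)$ is the set of families $(c_{y,a})_{\langle y,a\rangle\in P_x}$ with $c_{y,a}\in G(y,a)$ and $G(\delta^{y,a}_{z,b})(c_{y,a})=c_{z,b}$ for all arrows $\delta^{y,a}_{z,b}$ of $\int_XJ$ with $y\leq x$; $\Xi_JG(\delta^x_{x'})$ is the projection on $P_{x'}$. On attributes $\Pi_JG(A)=\prod_{a\in J(A)}G(A,a)$. For $t\in\mathrm{Trm}_{\int_XJ}(G)$, $\lambda t$ is $x\mapsto(t(y,a))_{\langle y,a\rangle\in P_x}$; for $s\in\mathrm{Trm}_X(\Xi_JG)$,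 $\mathrm{Ap}_s$ is $\langle x,a\rangle\mapsto s(x)_{x,a}$; both are transported along $\Xi_JG\cong\Pi_JG$. - $\Sigma_JG(x)=\{\langle a,b\rangle : a\in J(x),\ b\in G(x,a)\}$ with componentwise restriction maps; $\mathrm{pair}$ is the full tuple $\langle\langle x,a\rangle,b\rangle\mapsto\langle a,b\rangle$. - $\mathrm{Id}_J\in\mathrm{Rel}(\int_{\int_XJ}J[p])$ sends $\langle\langle x,a\rangle,b\rangle$ to $\{\star\}$ if $a=b$ and to $\emptyset$ otherwise; $\mathrm{refl}\in\mathrm{Trm}_{\int_XJ}(\mathrm{Id}_J[\hat v])$ is $\langle x,a\rangle\mapsto\star$. - For $I,J\in\mathrm{Rel}(X)$, $(I+J)(x)=\{\langle0,a\rangle : a\in I(x)\}\cup\{\langle1,a\rangle : a\in J(x)\}$; $\mathrm{left}\in\mathrm{Trm}_{\int_XI}((I+J)[p])$ is $\langle x,a\rangle\mapsto\langle0,a\rangle$ and $\mathrm{right}\in\mathrm{Trm}_{\int_XJ}((I+J)[p])$ is $\langle x,a\rangle\mapsto\langle1,a\rangle$. - $0_X$ is the constant functor $\emptyset$; $1_X$ is the instance $x\mapsto\{x\}$, and $*$ is its identity full tuple. - Eliminators: $\mathrm{rec}_\Sigma c_0$ is $\langle x,\langle a,b\rangle\rangle\mapsto c_0(\langle\langle x,a\rangle,b\rangle)$; $\mathrm{rec}_{Id}\,c_0$ is $\langle\langle\langle x,a\rangle,a\rangle,\star\rangle\mapsto c_0(\langle x,a\rangle)$; $\mathrm{rec}_+c_0c_1$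 is $\langle x,\langle0,a\rangle\rangle\mapsto c_0(\langle x,a\rangle)$, $\langle x,\langle1,b\rangle\rangle\mapsto c_1(\langle x,b\rangle)$; $\mathrm{rec}_0$ is the empty full tuple; $\mathrm{rec}_1c_0$ is $\langle x,*\rangle\mapsto c_0(x)$. **Judgements and their interpretation.** $\Gamma\ \mathtt{context}$: $\llbracket\Gamma\rrbracket$ is a schema. $\Gamma\vdash A\ \mathtt{type}$: $\llbracket A\rrbracket$ is an instance of $\llbracket\Gamma\rrbracket$. $\Gamma\vdash a:A$: $\llbracket a\rrbracket$ is a full tuple of $\llbracket A\rrbracket$. $\sigma:\Gamma\to\Lambda$: $\llbracket\sigma\rrbracket$ is a display morphism. The four equality judgements $\Gamma\equiv\Lambda$, $\Gamma\vdash A\equiv B$, $\Gamma\vdash t\equiv u:A$, $\sigma\equiv\tau:\Gamma\to\Lambda$ are interpreted as equality. **Formation, introduction and elimination rules.** Identity substitutions $id_\Gamma:\Gamma\to\Gamma$ and composites $\tau\circ\sigma$. If $\sigma:\Delta\to\Gamma$, $\Gamma\vdash A\ \mathtt{type}$ and $\Gamma\vdash a:A$, then $\Delta\vdash A[\sigma]\ \mathtt{type}$ and $\Delta\vdash a[\sigma]:A[\sigma]$. If $\Gamma\vdash A\ \mathtt{type}$: $\Gamma.A\ \mathtt{context}$; ${\downarrow}:\Gamma.A\to\Gamma$; $\Gamma.A\vdash v:A[\downarrow]$; if $\Gamma\vdash a:A$ then $a{\uparrow}:\Gamma\to\Gamma.A$; if $\sigma:\Delta\to\Gamma$ then $\sigma.A:\Delta.A[\sigma]\to\Gamma.A$.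 If $\Gamma.A\vdash B\ \mathtt{type}$: $\Gamma\vdash\Pi_AB\ \mathtt{type}$; $\Gamma.A\vdash b:B$ yields $\Gamma\vdash\lambda b:\Pi_AB$; $\Gamma\vdash f:\Pi_AB$ yields $\Gamma.A\vdash\mathrm{apply}\,f:B$; $\Gamma\vdash\Sigma_AB\ \mathtt{type}$; $\Gamma.A.B\vdash\mathrm{pair}:\Sigma_AB[\downarrow][\downarrow]$; from $\Gamma.\Sigma_AB\vdash C\ \mathtt{type}$ and $\Gamma.A.B\vdash c_0:C[(\downarrow\circ\downarrow).\Sigma_AB][\mathrm{pair}{\uparrow}]$ one has $\Gamma.\Sigma_AB\vdash\mathrm{rec}_\Sigma c_0:C$. $\Gamma.A.A[\downarrow]\vdash Id_A\ \mathtt{type}$; $\Gamma.A\vdash\mathrm{refl}:Id_A[v{\uparrow}]$; from $\Gamma.A.A[\downarrow].Id_A\vdash C\ \mathtt{type}$ and $\Gamma.A\vdash c_0:C[(v{\uparrow}).Id_A][\mathrm{refl}{\uparrow}]$ one has $\Gamma.A.A[\downarrow].Id_A\vdash\mathrm{rec}_{Id}\,c_0:C$. For $\Gamma\vdash A,B\ \mathtt{type}$: $\Gamma\vdash A+B\ \mathtt{type}$; $\Gamma.A\vdash\mathrm{left}:(A+B)[\downarrow]$; $\Gamma.B\vdash\mathrm{right}:(A+B)[\downarrow]$; from $\Gamma.(A+B)\vdash C\ \mathtt{type}$, $\Gamma.A\vdash c_0:C[\downarrow.(A+B)][\mathrm{left}{\uparrow}]$ and $\Gamma.B\vdash c_1:C[\downarrow.(A+B)][\mathrm{right}{\uparrow}]$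 one has $\Gamma.(A+B)\vdash\mathrm{rec}_+c_0c_1:C$. $\Gamma\vdash0\ \mathtt{type}$; from $\Gamma.0\vdash C\ \mathtt{type}$, $\Gamma.0\vdash\mathrm{rec}_0:C$. $\Gamma\vdash1\ \mathtt{type}$; $\Gamma\vdash*:1$; from $\Gamma.1\vdash C\ \mathtt{type}$ and $\Gamma\vdash c_0:C[*{\uparrow}]$, $\Gamma.1\vdash\mathrm{rec}_1c_0:C$. Constants: $\Delta_n\ \mathtt{context}$ and $d^n_i:\Delta_n\to\Delta_{n+1}$. **Interpretation.** $\llbracket\sigma\circ\tau\rrbracket=\llbracket\sigma\rrbracket\circ\llbracket\tau\rrbracket$; $\llbracket id_\Gamma\rrbracket=\mathrm{id}_{\llbracket\Gamma\rrbracket}$; $\llbracket A[\sigma]\rrbracket=\llbracket A\rrbracket\circ\llbracket\sigma\rrbracket$; $\llbracket a[\sigma]\rrbracket=\llbracket a\rrbracket[\llbracket\sigma\rrbracket]$; $\llbracket\Gamma.A\rrbracket=\int_{\llbracket\Gamma\rrbracket}\llbracket A\rrbracket$; $\llbracket\downarrow\rrbracket=p$; $\llbracket v\rrbracket=v$; $\llbracket a{\uparrow}\rrbracket=\widehat{\llbracket a\rrbracket}$; $\llbracket\sigma.A\rrbracket=\widetilde{\llbracket\sigma\rrbracket}$; $\llbracket\Pi_AB\rrbracket=\Pi_{\llbracket A\rrbracket}\llbracket B\rrbracket$, $\llbracket\lambda b\rrbracket=\lambda\llbracket b\rrbracket$, $\llbracket\mathrm{apply}\,f\rrbracket=\mathrm{Ap}_{\llbracket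 f\rrbracket}$; $\Sigma,Id,+,0,1$ and their constructors and eliminators are interpreted by the operations of the same name; $\llbracket\Delta_n\rrbracket=\Delta_n$, $\llbracket d^n_i\rrbracket=d^n_i$. **Equality rules** (for all contexts, types, terms and substitutions for which the expressions are well-formed; $\sigma:\Delta\to\Gamma$ and $\tau:\Theta\to\Delta$ unless otherwise indicated): - (E1) $(\upsilon\circ\tau)\circ\sigma\equiv\upsilon\circ(\tau\circ\sigma)$ for composable $\sigma,\tau,\upsilon$. - (E2) $id_\Gamma\circ\sigma\equiv\sigma$. - (E3) $\sigma\circ id_\Delta\equiv\sigma$. - (E4) $\Theta\vdash A[\sigma\circ\tau]\equiv A[\sigma][\tau]$. - (E5) $\Gamma\vdash A[id_\Gamma]\equiv A$. - (E6) $\Theta\vdash a[\sigma\circ\tau]\equiv a[\sigma][\tau]:A[\sigma][\tau]$. - (E7) $\Gamma\vdash a[id_\Gamma]\equiv a:A$. - (E8) $\downarrow\circ(a{\uparrow})\equiv id_\Gamma$, for $\Gamma\vdash a:A$. - (E9) $\Gamma\vdash v[a{\uparrow}]\equiv a:A$. - (E10) $\downarrow\circ(\sigma.A)\equiv\sigma\circ\downarrow:\Delta.A[\sigma]\to\Gamma$. - (E11) $\Delta.A[\sigma]\vdash v[\sigma.A]\equiv v:A[\sigma][\downarrow]$. - (E12) $(\sigma.A)\circ(a[\sigma]{\uparrow})\equiv a{\uparrow}\circ\sigma:\Delta\to\Gamma.A$. - (E13) $(\sigma.A)\circ(\tau.A[\sigma])\equiv(\sigma\circ\tau).A:\Theta.A[\sigma\circ\tau]\to\Gamma.A$.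 - (E14) $(\downarrow.A)\circ v{\uparrow}\equiv id_{\Gamma.A}$. - (E15) $\Delta\vdash(\Pi_AB)[\sigma]\equiv\Pi_{A[\sigma]}B[\sigma.A]$. - (E16) $\Gamma.A\vdash\mathrm{apply}(\lambda b)\equiv b:B$. - (E17) $\Gamma.A.B\vdash(\mathrm{rec}_\Sigma c_0)[(\downarrow\circ\downarrow).\Sigma_AB][\mathrm{pair}{\uparrow}]\equiv c_0:C[(\downarrow\circ\downarrow).\Sigma_AB][\mathrm{pair}{\uparrow}]$. - (E18) $\Gamma.A\vdash(\mathrm{rec}_{Id}\,c_0)[(v{\uparrow}).Id_A][\mathrm{refl}{\uparrow}]\equiv c_0:C[(v{\uparrow}).Id_A][\mathrm{refl}{\uparrow}]$. - (E19) $\Gamma.A\vdash(\mathrm{rec}_+c_0c_1)[\downarrow.(A+B)][\mathrm{left}{\uparrow}]\equiv c_0:C[\downarrow.(A+B)][\mathrm{left}{\uparrow}]$ and $\Gamma.B\vdash(\mathrm{rec}_+c_0c_1)[\downarrow.(A+B)][\mathrm{right}{\uparrow}]\equiv c_1:C[\downarrow.(A+B)][\mathrm{right}{\uparrow}]$. - (E20) $d^{n+1}_j\circ d^n_i\equiv d^{n+1}_i\circ d^n_{j-1}:\Delta_n\to\Delta_{n+2}$ for $0\le i<j\le n+2$. *)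

theory Defs
  imports Main "HOL-Library.FuncSet"
begin

section \<open>Simplicial schemas\<close>

text \<open>
  A finite poset is represented by its reflexive order relation \<open>X\<close>; its set of elements is
  \<open>Field X\<close>.  Throughout, \<open>(y, x) \<in> X\<close> means \<open>y \<le> x\<close> in the order of the complex, so that the
  schema, regarded as a category, has an arrow from \<open>x\<close> to \<open>y\<close> exactly when \<open>(y, x) \<in> X\<close>.
\<close>

definition is_basis :: "'x rel \<Rightarrow> 'x set \<Rightarrow> bool" where
  "is_basis X B \<longleftrightarrow> B \<subseteq> Field X \<and>
     (\<forall>x\<in>Field X. \<forall>y\<in>Field X.
        (x, y) \<in> X \<longleftrightarrow> {z \<in> B. (z, x) \<in> X} \<subseteq> {z \<in> B. (z, y) \<in> X}) \<and>
     (\<forall>z\<in>B. \<forall>w\<in>B. z \<noteq> w \<longrightarrow> (z, w) \<notin> X \<and> (w, z) \<notin> X) \<and>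
     (\<forall>x\<in>Field X. {z \<in> B. (z, x) \<in> X} \<noteq> {})"

definition based :: "'x rel \<Rightarrow> bool" where
  "based X \<longleftrightarrow> finite (Field X) \<and> Partial_order X \<and> (\<exists>B. is_basis X B)"

text \<open>The description below is meaningful because a basis is unique if it exists.\<close>

definition basis :: "'x rel \<Rightarrow> 'x set" where
  "basis X = (THE B. is_basis X B)"

definition attrs_below :: "'x rel \<Rightarrow> 'x \<Rightarrow> 'x set" where
  "attrs_below X x = {A \<in> basis X. (A, x) \<in> X}"

definition schema :: "'x rel \<Rightarrow> bool" where
  "schema X \<longleftrightarrow> based X \<and>
     (\<forall>x\<in>Field X. \<forall>Y. Y \<noteq> {} \<and> Y \<subseteq> attrs_below X x \<longrightarrow>
        (\<exists>y\<in>Field X. attrs_below X y = Y))"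

definition level :: "'x rel \<Rightarrow> nat \<Rightarrow> 'x set" where
  "level X n = {x \<in> Field X. card (attrs_below X x) = n + 1}"

text \<open>
  Morphisms are functions that are extensional on the source, so that equality of morphisms is
  equality in the logic.
\<close>

definition schema_morphism :: "'x rel \<Rightarrow> 'y rel \<Rightarrow> ('x \<Rightarrow> 'y) \<Rightarrow> bool" where
  "schema_morphism X Y f \<longleftrightarrow> schema X \<and> schema Y \<and> f \<in> Field X \<rightarrow>\<^sub>E Field Y \<and>
     (\<forall>x y. (y, x) \<in> X \<longrightarrow> (f y, f x) \<in> Y) \<and>
     (\<forall>x\<in>Field X. f ` attrs_below X x = attrs_below Y (f x))"

definition display :: "'x rel \<Rightarrow> 'y rel \<Rightarrow> ('x \<Rightarrow> 'y) \<Rightarrow> bool" where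
  "display X Y f \<longleftrightarrow> schema_morphism X Y f \<and> (\<forall>n. f ` level X n \<subseteq> level Y n)"

definition id_sub :: "'x rel \<Rightarrow> 'x \<Rightarrow> 'x" where
  "id_sub X = (\<lambda>x\<in>Field X. x)"

text \<open>\<open>comp_sub X g f\<close> is \<open>g \<circ> f\<close>, where \<open>X\<close> is the source of \<open>f\<close>.\<close>

definition comp_sub :: "'x rel \<Rightarrow> ('y \<Rightarrow> 'z) \<Rightarrow> ('x \<Rightarrow> 'y) \<Rightarrow> 'x \<Rightarrow> 'z" where
  "comp_sub X g f = compose (Field X) g f"

definition simplex :: "nat \<Rightarrow> nat set rel" where
  "simplex n = {(S, T). S \<noteq> {} \<and> S \<subseteq> T \<and> T \<subseteq> {0..n}}"

definition face :: "nat \<Rightarrow> nat \<Rightarrow> nat set \<Rightarrow> nat set" where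
  "face n i = (\<lambda>S\<in>Field (simplex n). (\<lambda>k. if k < i then k else k + 1) ` S)"


section \<open>Instances on tuple form\<close>

text \<open>
  A functor from a schema to finite sets is given by its values \<open>I x\<close> and its restriction maps,
  \<open>R x y :: I x \<Rightarrow> I y\<close> for \<open>y \<le> x\<close>.
\<close>

definition relational_instance ::
    "'x rel \<Rightarrow> ('x \<Rightarrow> 'k set) \<Rightarrow> ('x \<Rightarrow> 'x \<Rightarrow> 'k \<Rightarrow> 'k) \<Rightarrow> bool" where
  "relational_instance X I R \<longleftrightarrow> schema X \<and>
     (\<forall>x\<in>Field X. finite (I x)) \<and>
     (\<forall>x y. (y, x) \<in> X \<longrightarrow> R x y \<in> I x \<rightarrow> I y) \<and>
     (\<forall>x\<in>Field X. \<forall>k\<in>I x. R x x k = k) \<and>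
     (\<forall>x y z. (y, x) \<in> X \<and> (z, y) \<in> X \<longrightarrow> (\<forall>k\<in>I x. R y z (R x y k) = R x z k)) \<and>
     (\<forall>x\<in>Field X. \<forall>k\<in>I x. \<forall>l\<in>I x.
        (\<forall>A\<in>attrs_below X x. R x A k = R x A l) \<longrightarrow> k = l)"

text \<open>
  On tuple form, the elements at \<open>x\<close> are functions that are extensional on \<open>attrs_below X x\<close>.
  For an attribute \<open>A\<close>, \<open>J A\<close> consists of singleton tuples; \<open>vals J A\<close> is the set of their
  entries, and \<open>sing A v\<close> is the singleton tuple with entry \<open>v\<close>.
\<close>

definition sing :: "'x \<Rightarrow> 'v \<Rightarrow> 'x \<Rightarrow> 'v" where
  "sing A v = (\<lambda>_\<in>{A}. v)"

definition vals :: "('x \<Rightarrow> ('x \<Rightarrow> 'v) set) \<Rightarrow> 'x \<Rightarrow> 'v set" where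
  "vals J A = (\<lambda>k. k A) ` J A"

definition proj :: "'x rel \<Rightarrow> 'x \<Rightarrow> ('x \<Rightarrow> 'v) \<Rightarrow> 'x \<Rightarrow> 'v" where
  "proj X y k = restrict k (attrs_below X y)"

definition is_inst :: "'x rel \<Rightarrow> ('x \<Rightarrow> ('x \<Rightarrow> 'v) set) \<Rightarrow> bool" where
  "is_inst X J \<longleftrightarrow> J \<in> extensional (Field X) \<and>
     relational_instance X J (\<lambda>x y. proj X y) \<and>
     (\<forall>x\<in>Field X. J x \<subseteq> (\<Pi>\<^sub>E A\<in>attrs_below X x. vals J A))"

definition is_trm :: "'x rel \<Rightarrow> ('x \<Rightarrow> ('x \<Rightarrow> 'v) set) \<Rightarrow> ('x \<Rightarrow> 'x \<Rightarrow> 'v) \<Rightarrow> bool" where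
  "is_trm X J t \<longleftrightarrow> is_inst X J \<and> t \<in> (\<Pi>\<^sub>E x\<in>Field X. J x) \<and>
     (\<forall>x y. (y, x) \<in> X \<longrightarrow> proj X y (t x) = t y)"

text \<open>
  \<open>tup\<close> is the canonical isomorphism from an instance \<open>(I, R)\<close> to its tuplification.  Since
  singleton tuples are identified with their elements, an element of \<open>I A\<close> for an attribute \<open>A\<close>
  may itself involve singleton tuples; the parameter \<open>e\<close> (injective on each \<open>I A\<close>) carries out
  this identification by replacing those singleton tuples by their entries.
\<close>

definition tup ::
    "'x rel \<Rightarrow> ('x \<Rightarrow> 'k \<Rightarrow> 'v) \<Rightarrow> ('x \<Rightarrow> 'x \<Rightarrow> 'k \<Rightarrow> 'k) \<Rightarrow> 'x \<Rightarrow> 'k \<Rightarrow> 'x \<Rightarrow> 'v" where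
  "tup X e R x k = (\<lambda>A\<in>attrs_below X x. e A (R x A k))"

definition untup ::
    "'x rel \<Rightarrow> ('x \<Rightarrow> 'k \<Rightarrow> 'v) \<Rightarrow> ('x \<Rightarrow> 'k set) \<Rightarrow> ('x \<Rightarrow> 'x \<Rightarrow> 'k \<Rightarrow> 'k) \<Rightarrow> 'x
      \<Rightarrow> ('x \<Rightarrow> 'v) \<Rightarrow> 'k" where
  "untup X e I R x = inv_into (I x) (tup X e R x)"

definition tuplify ::
    "'x rel \<Rightarrow> ('x \<Rightarrow> 'k \<Rightarrow> 'v) \<Rightarrow> ('x \<Rightarrow> 'k set) \<Rightarrow> ('x \<Rightarrow> 'x \<Rightarrow> 'k \<Rightarrow> 'k)
      \<Rightarrow> 'x \<Rightarrow> ('x \<Rightarrow> 'v) set" where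
  "tuplify X e I R = (\<lambda>x\<in>Field X. tup X e R x ` I x)"

text \<open>
  For a display morphism \<open>f\<close> from \<open>X\<close> to \<open>Y\<close>, tuples indexed by \<open>attrs_below Y (f x)\<close> are
  identified with tuples indexed by \<open>attrs_below X x\<close>; \<open>reindex\<close> and \<open>unreindex\<close> are the two
  directions of this identification.
\<close>

definition reindex :: "'x rel \<Rightarrow> ('x \<Rightarrow> 'y) \<Rightarrow> 'x \<Rightarrow> ('y \<Rightarrow> 'v) \<Rightarrow> 'x \<Rightarrow> 'v" where
  "reindex X f x k = (\<lambda>A\<in>attrs_below X x. k (f A))"

definition unreindex ::
    "'x rel \<Rightarrow> 'y rel \<Rightarrow> ('x \<Rightarrow> 'y) \<Rightarrow> 'x \<Rightarrow> ('x \<Rightarrow> 'v) \<Rightarrow> 'y \<Rightarrow> 'v" where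
  "unreindex X Y f x k = (\<lambda>B\<in>attrs_below Y (f x). k (inv_into (attrs_below X x) f B))"


section \<open>Category of elements and substitution\<close>

definition elts :: "'x rel \<Rightarrow> ('x \<Rightarrow> ('x \<Rightarrow> 'v) set) \<Rightarrow> ('x \<times> ('x \<Rightarrow> 'v)) rel" where
  "elts X J = {((y, b), (x, a)). (y, x) \<in> X \<and> a \<in> J x \<and> b \<in> J y \<and> proj X y a = b}"

definition down :: "'x rel \<Rightarrow> ('x \<Rightarrow> ('x \<Rightarrow> 'v) set) \<Rightarrow> 'x \<times> ('x \<Rightarrow> 'v) \<Rightarrow> 'x" where
  "down X J = (\<lambda>(x, a)\<in>Field (elts X J). x)"

text \<open>In the following, \<open>f\<close> is a morphism from \<open>X\<close> to \<open>Y\<close>.\<close>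

definition inst_sub ::
    "'x rel \<Rightarrow> ('x \<Rightarrow> 'y) \<Rightarrow> ('y \<Rightarrow> ('y \<Rightarrow> 'v) set) \<Rightarrow> 'x \<Rightarrow> ('x \<Rightarrow> 'v) set" where
  "inst_sub X f J = (\<lambda>x\<in>Field X. reindex X f x ` J (f x))"

definition trm_sub :: "'x rel \<Rightarrow> ('x \<Rightarrow> 'y) \<Rightarrow> ('y \<Rightarrow> 'y \<Rightarrow> 'v) \<Rightarrow> 'x \<Rightarrow> 'x \<Rightarrow> 'v" where
  "trm_sub X f t = (\<lambda>x\<in>Field X. reindex X f x (t (f x)))"

definition hat :: "'y rel \<Rightarrow> ('y \<Rightarrow> 'y \<Rightarrow> 'v) \<Rightarrow> 'y \<Rightarrow> 'y \<times> ('y \<Rightarrow> 'v)" where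
  "hat Y t = (\<lambda>y\<in>Field Y. (y, t y))"

definition var ::
    "'y rel \<Rightarrow> ('y \<Rightarrow> ('y \<Rightarrow> 'v) set)
      \<Rightarrow> 'y \<times> ('y \<Rightarrow> 'v) \<Rightarrow> 'y \<times> ('y \<Rightarrow> 'v) \<Rightarrow> 'v" where
  "var Y J = (\<lambda>(y, a)\<in>Field (elts Y J). reindex (elts Y J) (down Y J) (y, a) a)"

definition tilde ::
    "'x rel \<Rightarrow> 'y rel \<Rightarrow> ('x \<Rightarrow> 'y) \<Rightarrow> ('y \<Rightarrow> ('y \<Rightarrow> 'v) set)
      \<Rightarrow> 'x \<times> ('x \<Rightarrow> 'v) \<Rightarrow> 'y \<times> ('y \<Rightarrow> 'v)" where
  "tilde X Y f J = (\<lambda>(x, a)\<in>Field (elts X (inst_sub X f J)). (f x, unreindex X Y f x a))"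


section \<open>Dependent products\<close>

definition Pi_index ::
    "'x rel \<Rightarrow> ('x \<Rightarrow> ('x \<Rightarrow> 'v) set) \<Rightarrow> 'x \<Rightarrow> ('x \<times> ('x \<Rightarrow> 'v)) set" where
  "Pi_index X J x = {(y, a). (y, x) \<in> X \<and> a \<in> J y}"

definition Xi_set ::
    "'x rel \<Rightarrow> ('x \<Rightarrow> ('x \<Rightarrow> 'v) set)
      \<Rightarrow> ('x \<times> ('x \<Rightarrow> 'v) \<Rightarrow> ('x \<times> ('x \<Rightarrow> 'v) \<Rightarrow> 'w) set)
      \<Rightarrow> 'x \<Rightarrow> ('x \<times> ('x \<Rightarrow> 'v) \<Rightarrow> 'x \<times> ('x \<Rightarrow> 'v) \<Rightarrow> 'w) set" where
  "Xi_set X J G x = {c \<in> (\<Pi>\<^sub>E p\<in>Pi_index X J x. G p).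
     \<forall>y a z b. ((z, b), (y, a)) \<in> elts X J \<and> (y, x) \<in> X
       \<longrightarrow> proj (elts X J) (z, b) (c (y, a)) = c (z, b)}"

definition Xi_map ::
    "'x rel \<Rightarrow> ('x \<Rightarrow> ('x \<Rightarrow> 'v) set) \<Rightarrow> 'x \<Rightarrow> 'x
      \<Rightarrow> ('x \<times> ('x \<Rightarrow> 'v) \<Rightarrow> 'x \<times> ('x \<Rightarrow> 'v) \<Rightarrow> 'w)
      \<Rightarrow> ('x \<times> ('x \<Rightarrow> 'v) \<Rightarrow> 'x \<times> ('x \<Rightarrow> 'v) \<Rightarrow> 'w)" where
  "Xi_map X J x x' c = restrict c (Pi_index X J x')"

text \<open>
  At an attribute \<open>A\<close>, a family \<open>c\<close> is indexed by the pairs \<open>(A, a)\<close> with \<open>a \<in> J A\<close>, and each of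
  its members is a singleton tuple; replacing singleton tuples by their entries makes it an
  element of the product of the sets \<open>vals G (A, a)\<close>.
\<close>

definition Pi_entry ::
    "('x \<Rightarrow> ('x \<Rightarrow> 'v) set) \<Rightarrow> 'x
      \<Rightarrow> ('x \<times> ('x \<Rightarrow> 'v) \<Rightarrow> 'x \<times> ('x \<Rightarrow> 'v) \<Rightarrow> 'w) \<Rightarrow> 'v \<Rightarrow> 'w" where
  "Pi_entry J A c = (\<lambda>v\<in>vals J A. c (A, sing A v) (A, sing A v))"

definition Pi_inst ::
    "'x rel \<Rightarrow> ('x \<Rightarrow> ('x \<Rightarrow> 'v) set)
      \<Rightarrow> ('x \<times> ('x \<Rightarrow> 'v) \<Rightarrow> ('x \<times> ('x \<Rightarrow> 'v) \<Rightarrow> 'w) set)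
      \<Rightarrow> 'x \<Rightarrow> ('x \<Rightarrow> 'v \<Rightarrow> 'w) set" where
  "Pi_inst X J G = tuplify X (Pi_entry J) (Xi_set X J G) (Xi_map X J)"

definition lam ::
    "'x rel \<Rightarrow> ('x \<Rightarrow> ('x \<Rightarrow> 'v) set) \<Rightarrow> ('x \<times> ('x \<Rightarrow> 'v) \<Rightarrow> 'x \<times> ('x \<Rightarrow> 'v) \<Rightarrow> 'w)
      \<Rightarrow> 'x \<Rightarrow> 'x \<Rightarrow> 'v \<Rightarrow> 'w" where
  "lam X J t =
     (\<lambda>x\<in>Field X. tup X (Pi_entry J) (Xi_map X J) x (\<lambda>(y, a)\<in>Pi_index X J x. t (y, a)))"

definition app ::
    "'x rel \<Rightarrow> ('x \<Rightarrow> ('x \<Rightarrow> 'v) set)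
      \<Rightarrow> ('x \<times> ('x \<Rightarrow> 'v) \<Rightarrow> ('x \<times> ('x \<Rightarrow> 'v) \<Rightarrow> 'w) set)
      \<Rightarrow> ('x \<Rightarrow> 'x \<Rightarrow> 'v \<Rightarrow> 'w) \<Rightarrow> 'x \<times> ('x \<Rightarrow> 'v) \<Rightarrow> 'x \<times> ('x \<Rightarrow> 'v) \<Rightarrow> 'w" where
  "app X J G s = (\<lambda>(x, a)\<in>Field (elts X J).
     untup X (Pi_entry J) (Xi_set X J G) (Xi_map X J) x (s x) (x, a))"


section \<open>Dependent sums\<close>

definition Sigma_set ::
    "('x \<Rightarrow> ('x \<Rightarrow> 'v) set) \<Rightarrow> ('x \<times> ('x \<Rightarrow> 'v) \<Rightarrow> ('x \<times> ('x \<Rightarrow> 'v) \<Rightarrow> 'w) set)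
      \<Rightarrow> 'x \<Rightarrow> (('x \<Rightarrow> 'v) \<times> ('x \<times> ('x \<Rightarrow> 'v) \<Rightarrow> 'w)) set" where
  "Sigma_set J G x = {(a, b). a \<in> J x \<and> b \<in> G (x, a)}"

definition Sigma_map ::
    "'x rel \<Rightarrow> ('x \<Rightarrow> ('x \<Rightarrow> 'v) set) \<Rightarrow> 'x \<Rightarrow> 'x
      \<Rightarrow> ('x \<Rightarrow> 'v) \<times> ('x \<times> ('x \<Rightarrow> 'v) \<Rightarrow> 'w)
      \<Rightarrow> ('x \<Rightarrow> 'v) \<times> ('x \<times> ('x \<Rightarrow> 'v) \<Rightarrow> 'w)" where
  "Sigma_map X J x y = (\<lambda>(a, b). (proj X y a, proj (elts X J) (y, proj X y a) b))"

definition Sigma_entry ::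
    "'x \<Rightarrow> ('x \<Rightarrow> 'v) \<times> ('x \<times> ('x \<Rightarrow> 'v) \<Rightarrow> 'w) \<Rightarrow> 'v \<times> 'w" where
  "Sigma_entry A = (\<lambda>(a, b). (a A, b (A, a)))"

definition Sigma_inst ::
    "'x rel \<Rightarrow> ('x \<Rightarrow> ('x \<Rightarrow> 'v) set)
      \<Rightarrow> ('x \<times> ('x \<Rightarrow> 'v) \<Rightarrow> ('x \<times> ('x \<Rightarrow> 'v) \<Rightarrow> 'w) set)
      \<Rightarrow> 'x \<Rightarrow> ('x \<Rightarrow> 'v \<times> 'w) set" where
  "Sigma_inst X J G = tuplify X Sigma_entry (Sigma_set J G) (Sigma_map X J)"

text \<open>
  \<open>pair_pt\<close> sends the element \<open>\<langle>\<langle>x, a\<rangle>, b\<rangle>\<close> to \<open>\<langle>x, \<langle>a, b\<rangle>\<rangle>\<close>, with \<open>\<langle>a, b\<rangle>\<close> on tuple form.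
\<close>

definition pair_pt ::
    "'x rel \<Rightarrow> ('x \<Rightarrow> ('x \<Rightarrow> 'v) set)
      \<Rightarrow> ('x \<times> ('x \<Rightarrow> 'v)) \<times> ('x \<times> ('x \<Rightarrow> 'v) \<Rightarrow> 'w) \<Rightarrow> 'x \<times> ('x \<Rightarrow> 'v \<times> 'w)" where
  "pair_pt X J = (\<lambda>((x, a), b). (x, tup X Sigma_entry (Sigma_map X J) x (a, b)))"

definition pair_trm ::
    "'x rel \<Rightarrow> ('x \<Rightarrow> ('x \<Rightarrow> 'v) set)
      \<Rightarrow> ('x \<times> ('x \<Rightarrow> 'v) \<Rightarrow> ('x \<times> ('x \<Rightarrow> 'v) \<Rightarrow> 'w) set)
      \<Rightarrow> ('x \<times> ('x \<Rightarrow> 'v)) \<times> ('x \<times> ('x \<Rightarrow> 'v) \<Rightarrow> 'w)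
      \<Rightarrow> ('x \<times> ('x \<Rightarrow> 'v)) \<times> ('x \<times> ('x \<Rightarrow> 'v) \<Rightarrow> 'w) \<Rightarrow> 'v \<times> 'w" where
  "pair_trm X J G = (\<lambda>((x, a), b)\<in>Field (elts (elts X J) G).
     reindex (elts (elts X J) G) (\<lambda>((y, _), _). y) ((x, a), b)
       (tup X Sigma_entry (Sigma_map X J) x (a, b)))"

definition rec_Sigma ::
    "'x rel \<Rightarrow> ('x \<Rightarrow> ('x \<Rightarrow> 'v) set)
      \<Rightarrow> ('x \<times> ('x \<Rightarrow> 'v) \<Rightarrow> ('x \<times> ('x \<Rightarrow> 'v) \<Rightarrow> 'w) set)
      \<Rightarrow> (('x \<times> ('x \<Rightarrow> 'v)) \<times> ('x \<times> ('x \<Rightarrow> 'v) \<Rightarrow> 'w)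
          \<Rightarrow> ('x \<times> ('x \<Rightarrow> 'v)) \<times> ('x \<times> ('x \<Rightarrow> 'v) \<Rightarrow> 'w) \<Rightarrow> 'u)
      \<Rightarrow> 'x \<times> ('x \<Rightarrow> 'v \<times> 'w) \<Rightarrow> 'x \<times> ('x \<Rightarrow> 'v \<times> 'w) \<Rightarrow> 'u" where
  "rec_Sigma X J G c0 = (\<lambda>(x, k)\<in>Field (elts X (Sigma_inst X J G)).
     case untup X Sigma_entry (Sigma_set J G) (Sigma_map X J) x k of (a, b) \<Rightarrow>
       unreindex (elts (elts X J) G) (elts X (Sigma_inst X J G)) (pair_pt X J) ((x, a), b)
         (c0 ((x, a), b)))"


section \<open>Identity types\<close>

text \<open>
  For \<open>\<langle>\<langle>x, a\<rangle>, b\<rangle>\<close> with \<open>b \<in> J[p](x, a)\<close>, the tuple \<open>b\<close> is indexed by the attributes below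
  \<open>\<langle>x, a\<rangle>\<close>, so it is compared with \<open>a\<close> after reindexing \<open>a\<close> along \<open>p\<close>.
\<close>

definition Id_ctx ::
    "'x rel \<Rightarrow> ('x \<Rightarrow> ('x \<Rightarrow> 'v) set)
      \<Rightarrow> (('x \<times> ('x \<Rightarrow> 'v)) \<times> ('x \<times> ('x \<Rightarrow> 'v) \<Rightarrow> 'v)) rel" where
  "Id_ctx X J = elts (elts X J) (inst_sub (elts X J) (down X J) J)"

definition Id_set ::
    "'x rel \<Rightarrow> ('x \<Rightarrow> ('x \<Rightarrow> 'v) set)
      \<Rightarrow> ('x \<times> ('x \<Rightarrow> 'v)) \<times> ('x \<times> ('x \<Rightarrow> 'v) \<Rightarrow> 'v) \<Rightarrow> unit set" where
  "Id_set X J = (\<lambda>((x, a), b).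
     if reindex (elts X J) (down X J) (x, a) a = b then {()} else {})"

definition Id_inst ::
    "'x rel \<Rightarrow> ('x \<Rightarrow> ('x \<Rightarrow> 'v) set)
      \<Rightarrow> ('x \<times> ('x \<Rightarrow> 'v)) \<times> ('x \<times> ('x \<Rightarrow> 'v) \<Rightarrow> 'v)
      \<Rightarrow> (('x \<times> ('x \<Rightarrow> 'v)) \<times> ('x \<times> ('x \<Rightarrow> 'v) \<Rightarrow> 'v) \<Rightarrow> unit) set" where
  "Id_inst X J = tuplify (Id_ctx X J) (\<lambda>_ u. u) (Id_set X J) (\<lambda>_ _ u. u)"

definition refl_trm ::
    "'x rel \<Rightarrow> ('x \<Rightarrow> ('x \<Rightarrow> 'v) set) \<Rightarrow> 'x \<times> ('x \<Rightarrow> 'v) \<Rightarrow> 'x \<times> ('x \<Rightarrow> 'v) \<Rightarrow> unit" where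
  "refl_trm X J = (\<lambda>w\<in>Field (elts X J).
     reindex (elts X J) (hat (elts X J) (var X J)) w
       (tup (Id_ctx X J) (\<lambda>_ u. u) (\<lambda>_ _ u. u) (hat (elts X J) (var X J) w) ()))"

text \<open>\<open>refl_pt\<close> sends \<open>\<langle>x, a\<rangle>\<close> to \<open>\<langle>\<langle>\<langle>x, a\<rangle>, a\<rangle>, \<star>\<rangle>\<close>, with both entries on tuple form.\<close>

definition refl_pt ::
    "'x rel \<Rightarrow> ('x \<Rightarrow> ('x \<Rightarrow> 'v) set) \<Rightarrow> 'x \<times> ('x \<Rightarrow> 'v)
      \<Rightarrow> (('x \<times> ('x \<Rightarrow> 'v)) \<times> ('x \<times> ('x \<Rightarrow> 'v) \<Rightarrow> 'v))
        \<times> (('x \<times> ('x \<Rightarrow> 'v)) \<times> ('x \<times> ('x \<Rightarrow> 'v) \<Rightarrow> 'v) \<Rightarrow> unit)" where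
  "refl_pt X J = (\<lambda>(x, a).
     let q = ((x, a), reindex (elts X J) (down X J) (x, a) a)
     in (q, tup (Id_ctx X J) (\<lambda>_ u. u) (\<lambda>_ _ u. u) q ()))"

definition rec_Id ::
    "'x rel \<Rightarrow> ('x \<Rightarrow> ('x \<Rightarrow> 'v) set)
      \<Rightarrow> ('x \<times> ('x \<Rightarrow> 'v) \<Rightarrow> 'x \<times> ('x \<Rightarrow> 'v) \<Rightarrow> 'u)
      \<Rightarrow> (('x \<times> ('x \<Rightarrow> 'v)) \<times> ('x \<times> ('x \<Rightarrow> 'v) \<Rightarrow> 'v))
          \<times> (('x \<times> ('x \<Rightarrow> 'v)) \<times> ('x \<times> ('x \<Rightarrow> 'v) \<Rightarrow> 'v) \<Rightarrow> unit)
      \<Rightarrow> (('x \<times> ('x \<Rightarrow> 'v)) \<times> ('x \<times> ('x \<Rightarrow> 'v) \<Rightarrow> 'v))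
          \<times> (('x \<times> ('x \<Rightarrow> 'v)) \<times> ('x \<times> ('x \<Rightarrow> 'v) \<Rightarrow> 'v) \<Rightarrow> unit)
      \<Rightarrow> 'u" where
  "rec_Id X J c0 = (\<lambda>(((x, a), b), s)\<in>Field (elts (Id_ctx X J) (Id_inst X J)).
     unreindex (elts X J) (elts (Id_ctx X J) (Id_inst X J)) (refl_pt X J) (x, a) (c0 (x, a)))"


section \<open>Binary sums\<close>

definition Plus_set ::
    "('x \<Rightarrow> ('x \<Rightarrow> 'v) set) \<Rightarrow> ('x \<Rightarrow> ('x \<Rightarrow> 'w) set)
      \<Rightarrow> 'x \<Rightarrow> (('x \<Rightarrow> 'v) + ('x \<Rightarrow> 'w)) set" where
  "Plus_set I J x = I x <+> J x"

definition Plus_map ::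
    "'x rel \<Rightarrow> 'x \<Rightarrow> 'x \<Rightarrow> ('x \<Rightarrow> 'v) + ('x \<Rightarrow> 'w) \<Rightarrow> ('x \<Rightarrow> 'v) + ('x \<Rightarrow> 'w)" where
  "Plus_map X x y = map_sum (proj X y) (proj X y)"

definition Plus_entry :: "'x \<Rightarrow> ('x \<Rightarrow> 'v) + ('x \<Rightarrow> 'w) \<Rightarrow> 'v + 'w" where
  "Plus_entry A = map_sum (\<lambda>a. a A) (\<lambda>b. b A)"

definition Plus_inst ::
    "'x rel \<Rightarrow> ('x \<Rightarrow> ('x \<Rightarrow> 'v) set) \<Rightarrow> ('x \<Rightarrow> ('x \<Rightarrow> 'w) set)
      \<Rightarrow> 'x \<Rightarrow> ('x \<Rightarrow> 'v + 'w) set" where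
  "Plus_inst X I J = tuplify X Plus_entry (Plus_set I J) (Plus_map X)"

definition left_trm ::
    "'x rel \<Rightarrow> ('x \<Rightarrow> ('x \<Rightarrow> 'v) set) \<Rightarrow> 'x \<times> ('x \<Rightarrow> 'v) \<Rightarrow> 'x \<times> ('x \<Rightarrow> 'v) \<Rightarrow> 'v + 'w" where
  "left_trm X I = (\<lambda>(x, a)\<in>Field (elts X I).
     reindex (elts X I) (down X I) (x, a) (tup X Plus_entry (Plus_map X) x (Inl a)))"

definition right_trm ::
    "'x rel \<Rightarrow> ('x \<Rightarrow> ('x \<Rightarrow> 'w) set) \<Rightarrow> 'x \<times> ('x \<Rightarrow> 'w) \<Rightarrow> 'x \<times> ('x \<Rightarrow> 'w) \<Rightarrow> 'v + 'w" where
  "right_trm X J = (\<lambda>(x, b)\<in>Field (elts X J).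
     reindex (elts X J) (down X J) (x, b) (tup X Plus_entry (Plus_map X) x (Inr b)))"

definition left_pt :: "'x rel \<Rightarrow> 'x \<times> ('x \<Rightarrow> 'v) \<Rightarrow> 'x \<times> ('x \<Rightarrow> 'v + 'w)" where
  "left_pt X = (\<lambda>(x, a). (x, tup X Plus_entry (Plus_map X) x (Inl a)))"

definition right_pt :: "'x rel \<Rightarrow> 'x \<times> ('x \<Rightarrow> 'w) \<Rightarrow> 'x \<times> ('x \<Rightarrow> 'v + 'w)" where
  "right_pt X = (\<lambda>(x, b). (x, tup X Plus_entry (Plus_map X) x (Inr b)))"

definition rec_Plus ::
    "'x rel \<Rightarrow> ('x \<Rightarrow> ('x \<Rightarrow> 'v) set) \<Rightarrow> ('x \<Rightarrow> ('x \<Rightarrow> 'w) set)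
      \<Rightarrow> ('x \<times> ('x \<Rightarrow> 'v) \<Rightarrow> 'x \<times> ('x \<Rightarrow> 'v) \<Rightarrow> 'u)
      \<Rightarrow> ('x \<times> ('x \<Rightarrow> 'w) \<Rightarrow> 'x \<times> ('x \<Rightarrow> 'w) \<Rightarrow> 'u)
      \<Rightarrow> 'x \<times> ('x \<Rightarrow> 'v + 'w) \<Rightarrow> 'x \<times> ('x \<Rightarrow> 'v + 'w) \<Rightarrow> 'u" where
  "rec_Plus X I J c0 c1 = (\<lambda>(x, k)\<in>Field (elts X (Plus_inst X I J)).
     case untup X Plus_entry (Plus_set I J) (Plus_map X) x k of
       Inl a \<Rightarrow> unreindex (elts X I) (elts X (Plus_inst X I J)) (left_pt X) (x, a) (c0 (x, a))
     | Inr b \<Rightarrow> unreindex (elts X J) (elts X (Plus_inst X I J)) (right_pt X) (x, b) (c1 (x, b)))"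


section \<open>Interpretation of the equality judgements\<close>

text \<open>
  An equality judgement holds if both sides interpret the underlying judgement (that is, they are
  instances of the stated schema, full tuples of the stated instance, or display morphisms
  between the stated schemas) and are equal.
\<close>

definition eq_type :: "'x rel \<Rightarrow> ('x \<Rightarrow> ('x \<Rightarrow> 'v) set) \<Rightarrow> ('x \<Rightarrow> ('x \<Rightarrow> 'v) set) \<Rightarrow> bool" where
  "eq_type X A B \<longleftrightarrow> is_inst X A \<and> is_inst X B \<and> A = B"

definition eq_trm ::
    "'x rel \<Rightarrow> ('x \<Rightarrow> ('x \<Rightarrow> 'v) set) \<Rightarrow> ('x \<Rightarrow> 'x \<Rightarrow> 'v) \<Rightarrow> ('x \<Rightarrow> 'x \<Rightarrow> 'v) \<Rightarrow> bool" where
  "eq_trm X A t u \<longleftrightarrow> is_trm X A t \<and> is_trm X A u \<and> t = u"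

definition eq_sub :: "'x rel \<Rightarrow> 'y rel \<Rightarrow> ('x \<Rightarrow> 'y) \<Rightarrow> ('x \<Rightarrow> 'y) \<Rightarrow> bool" where
  "eq_sub X Y f g \<longleftrightarrow> display X Y f \<and> display X Y g \<and> f = g"

end

theory Submission
  imports Defs
begin

text \<open>
  Everything rests on one observation: an element of a schema is determined by the set of attributes
  below it, and the order is inclusion of these sets. A display morphism is therefore the same thing as
  a function that is bijective from the attributes below \<open>x\<close> to those below \<open>f x\<close>
  (\<open>display_iff\<close>), and it identifies the whole order ideal below \<open>x\<close> with the one below
  \<open>f x\<close> (\<open>display_below\<close>, \<open>display_inj_below\<close>). On tuple form the same happens to
  instances: a tuple is determined by its entries, the restriction maps are restrictions of functions,
  and substitution renames the indices of tuples along such bijections. Renaming is functorial, so the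
  rules for composition and identity hold on the nose.

  For context extension, the attributes below an element \<open>(x, a)\<close> of the schema of elements are
  the entries of \<open>a\<close>, each tagged with its index. Hence a display morphism \<open>f\<close> together with
  a compatible choice of elements \<open>g x \<in> J (f x)\<close>, called a section along \<open>f\<close> below, lifts
  to a display morphism \<open>x \<mapsto> (f x, g x)\<close> (\<open>section_display\<close>); renaming the same section
  gives a full tuple of \<open>J[f]\<close> (\<open>section_trm\<close>), and \<open>tilde\<close> composed with the hat of
  that full tuple is the lift again (\<open>tilde_section\<close>). The substitution rules for \<open>hat\<close>,
  \<open>var\<close> and \<open>tilde\<close> are read off from these facts.

  The type formers of dependent sums, products, identity types and binary sums are tuplifications, and
  the canonical isomorphism with the tuplification is invertible because the restriction maps to
  attributes are jointly injective (\<open>untup_tup\<close>). Each introduction term is a section, and each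
  eliminator was defined on the image of the corresponding lift by the inverse renaming, so the
  computation rules of dependent sums, identity types and binary sums follow from the single lemma
  \<open>eliminator_computation\<close>. Beta reduction for products is \<open>untup_tup\<close> once more.
  Stability of products under substitution (\<open>Pi_inst_sub\<close>) is where the isomorphism of order
  ideals is needed: a matching family over the ideal below \<open>f x\<close> is renamed to one over the ideal
  below \<open>x\<close>, and the tuplified entries of the two agree. The face maps are injective on vertices,
  hence display, and the simplicial identity is checked on vertices.
\<close>


section \<open>Schemas and their attributes\<close>

text \<open>
  Any basis consists of the minimal elements, whence uniqueness.
\<close>

lemma is_basis_unique:
  assumes "Partial_order X" "is_basis X B" "is_basis X C"
  shows "B = C"
proof -
  have tr: "trans X" and as: "antisym X" using assms(1) by (auto simp: order_on_defs)
  have sub: "B \<subseteq> C" if B: "is_basis X B" and C: "is_basis X C" for B C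
  proof
    fix b assume b: "b \<in> B"
    then have "b \<in> Field X" using B unfolding is_basis_def by blast
    \<comment> \<open>an element of \<open>C\<close> lies below \<open>b\<close>, an element of \<open>B\<close> below that one; incomparability
      in \<open>B\<close> collapses the chain\<close>
    then obtain c where c: "c \<in> C" "(c, b) \<in> X" using C unfolding is_basis_def by blast
    then have "c \<in> Field X" by (auto simp: Field_def)
    then obtain d where d: "d \<in> B" "(d, c) \<in> X" using B unfolding is_basis_def by blast
    have "(d, b) \<in> X" using transD[OF tr d(2) c(2)] .
    then have "d = b" using B b d(1) unfolding is_basis_def by blast
    then have "b = c" using antisymD[OF as] c(2) d(2) by blast
    then show "b \<in> C" using c(1) by simp
  qed
  show ?thesis using sub[OF assms(2,3)] sub[OF assms(3,2)] by simp
qed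

lemma basis_eqI:
  assumes "Partial_order X" "is_basis X B"
  shows "basis X = B"
  unfolding basis_def
  by (rule the_equality, rule assms(2), erule is_basis_unique[OF assms(1) _ assms(2)])

text \<open>
  In practice a schema is presented by a set of faces, each with its nonempty set of attributes
  (its vertices), ordered by inclusion of these sets. This criterion serves for schemas of elements
  and for simplices, and it computes the basis and the attributes at the same time.
\<close>

lemma schema_of_attributes:
  fixes X :: "'x rel" and att :: "'x \<Rightarrow> 'x set"
  assumes fin: "finite F"
    and X: "\<And>x y. (x, y) \<in> X \<longleftrightarrow> x \<in> F \<and> y \<in> F \<and> att x \<subseteq> att y"
    and inj: "\<And>x y. x \<in> F \<Longrightarrow> y \<in> F \<Longrightarrow> att x = att y \<Longrightarrow> x = y"
    and att: "\<And>x. x \<in> F \<Longrightarrow> att x \<noteq> {} \<and> att x \<subseteq> B"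
    and B: "B \<subseteq> F" "\<And>b. b \<in> B \<Longrightarrow> att b = {b}"
    and sub: "\<And>x Y. x \<in> F \<Longrightarrow> Y \<noteq> {} \<Longrightarrow> Y \<subseteq> att x \<Longrightarrow> \<exists>y\<in>F. att y = Y"
  shows "schema X \<and> Field X = F \<and> basis X = B \<and> (\<forall>x\<in>F. attrs_below X x = att x)"
proof -
  have F: "Field X = F" using X unfolding Field_def by auto
  have "Refl X" unfolding refl_on_def F using X by auto
  moreover have "trans X" by (rule transI) (use X in blast)
  moreover have "antisym X" by (rule antisymI) (use X inj in blast)
  moreover have "X \<subseteq> Field X \<times> Field X" by (auto simp: Field_def)
  ultimately have po: "Partial_order X" unfolding order_on_defs by blast
  have below: "{z \<in> B. (z, x) \<in> X} = att x" if "x \<in> F" for x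
    using that B att[OF that] unfolding X by fastforce
  have "(x, y) \<in> X \<longleftrightarrow> {z \<in> B. (z, x) \<in> X} \<subseteq> {z \<in> B. (z, y) \<in> X}"
    if "x \<in> F" "y \<in> F" for x y
    unfolding below[OF that(1)] below[OF that(2)] using that X by simp
  moreover have "(z, w) \<notin> X" if "z \<in> B" "w \<in> B" "z \<noteq> w" for z w
    using X B that by auto
  moreover have "{z \<in> B. (z, x) \<in> X} \<noteq> {}" if "x \<in> F" for x
    using below[OF that] att[OF that] by simp
  ultimately have ba: "is_basis X B"
    unfolding is_basis_def F using B(1) by simp
  have bas: "basis X = B" by (rule basis_eqI[OF po ba])
  have ab: "attrs_below X x = att x" if "x \<in> F" for x
    unfolding attrs_below_def bas using below[OF that] .
  have "\<exists>y\<in>F. attrs_below X y = Y" if "x \<in> F" "Y \<noteq> {}" "Y \<subseteq> attrs_below X x" for x Y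
    using sub[of x Y] that ab by (auto simp: ab)
  then have "schema X"
    unfolding schema_def based_def using fin po ba F by auto
  then show ?thesis using F bas ab by blast
qed

lemma schema_Partial_order: "schema X \<Longrightarrow> Partial_order X"
  by (simp add: schema_def based_def)

lemma schema_finite: "schema X \<Longrightarrow> finite (Field X)"
  by (simp add: schema_def based_def)

lemma schema_is_basis: "schema X \<Longrightarrow> is_basis X (basis X)"
  unfolding schema_def based_def using basis_eqI by metis

lemma schema_refl: "schema X \<Longrightarrow> x \<in> Field X \<Longrightarrow> (x, x) \<in> X"
  using schema_Partial_order[of X] by (auto simp: order_on_defs refl_on_def)

lemma schema_trans: "schema X \<Longrightarrow> (x, y) \<in> X \<Longrightarrow> (y, z) \<in> X \<Longrightarrow> (x, z) \<in> X"
  using schema_Partial_order[of X] by (auto simp: order_on_defs elim: transE)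

lemma schema_antisym: "schema X \<Longrightarrow> (x, y) \<in> X \<Longrightarrow> (y, x) \<in> X \<Longrightarrow> x = y"
  using schema_Partial_order[of X] by (auto simp: order_on_defs dest: antisymD)

lemma rel_Field: "(y, x) \<in> X \<Longrightarrow> x \<in> Field X \<and> y \<in> Field X"
  by (auto simp: Field_def)

lemma attrs_Field: "A \<in> attrs_below X x \<Longrightarrow> A \<in> Field X \<and> x \<in> Field X"
  by (auto simp: attrs_below_def Field_def)

lemma attrs_rel: "A \<in> attrs_below X x \<Longrightarrow> (A, x) \<in> X"
  by (simp add: attrs_below_def)

lemma finite_attrs: "schema X \<Longrightarrow> finite (attrs_below X x)"
  by (rule finite_subset[OF _ schema_finite[of X]]) (auto dest: attrs_Field)

lemma attrs_nonempty: "schema X \<Longrightarrow> x \<in> Field X \<Longrightarrow> attrs_below X x \<noteq> {}"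
  using schema_is_basis[of X] unfolding is_basis_def attrs_below_def by blast

lemma attrs_mono: "schema X \<Longrightarrow> (y, x) \<in> X \<Longrightarrow> attrs_below X y \<subseteq> attrs_below X x"
  unfolding attrs_below_def using schema_trans[of X] by blast

lemma rel_iff_attrs:
  assumes "schema X" "x \<in> Field X" "y \<in> Field X"
  shows "(y, x) \<in> X \<longleftrightarrow> attrs_below X y \<subseteq> attrs_below X x"
  using schema_is_basis[OF assms(1)] assms(2,3) unfolding is_basis_def attrs_below_def by blast

lemma attrs_inject:
  assumes "schema X" "x \<in> Field X" "y \<in> Field X" "attrs_below X x = attrs_below X y"
  shows "x = y"
proof (rule schema_antisym[OF assms(1)])
  show "(x, y) \<in> X" "(y, x) \<in> X"
    using assms(4) rel_iff_attrs[OF assms(1,2,3)] rel_iff_attrs[OF assms(1,3,2)] by simp_all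
qed

lemma basis_Field: "schema X \<Longrightarrow> basis X \<subseteq> Field X"
  using schema_is_basis[of X] unfolding is_basis_def by blast

lemma attrs_attr:
  assumes "schema X" "A \<in> basis X"
  shows "attrs_below X A = {A}"
proof -
  have "(A, A) \<in> X" using basis_Field[OF assms(1)] schema_refl[OF assms(1)] assms(2) by auto
  moreover have "B = A" if "B \<in> basis X" "(B, A) \<in> X" for B
    using schema_is_basis[OF assms(1)] assms(2) that unfolding is_basis_def by metis
  ultimately show ?thesis using assms(2) by (auto simp: attrs_below_def)
qed

lemma attrs_attr_below: "schema X \<Longrightarrow> A \<in> attrs_below X x \<Longrightarrow> attrs_below X A = {A}"
  by (rule attrs_attr, assumption) (simp add: attrs_below_def)

lemma below_attr: "schema X \<Longrightarrow> A \<in> basis X \<Longrightarrow> (y, A) \<in> X \<Longrightarrow> y = A"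
  using attrs_nonempty[of X y] attrs_mono[of X y A] attrs_attr[of X A] rel_Field[of y A X]
    attrs_inject[of X y A] by auto

lemma face_exists:
  assumes "schema X" "x \<in> Field X" "Y \<noteq> {}" "Y \<subseteq> attrs_below X x"
  obtains y where "y \<in> Field X" "attrs_below X y = Y" "(y, x) \<in> X"
  using assms rel_iff_attrs[of X x] unfolding schema_def by blast

lemma attr_in_basis: "A \<in> attrs_below X x \<Longrightarrow> A \<in> basis X"
  by (simp add: attrs_below_def)


section \<open>Display morphisms\<close>

text \<open>
  The working description of display morphisms: on attributes they are bijections, and since the
  order of a schema is inclusion of attribute sets, monotonicity comes for free.
\<close>

lemma display_iff:
  "display X Y f \<longleftrightarrow> schema X \<and> schema Y \<and> f \<in> Field X \<rightarrow>\<^sub>E Field Y \<and>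
     (\<forall>x\<in>Field X. bij_betw f (attrs_below X x) (attrs_below Y (f x)))"
  (is "_ \<longleftrightarrow> ?R")
proof
  assume d: "display X Y f"
  then have X: "schema X" and f: "f \<in> Field X \<rightarrow>\<^sub>E Field Y"
    and img: "\<And>x. x \<in> Field X \<Longrightarrow> f ` attrs_below X x = attrs_below Y (f x)"
    and lev: "\<And>n. f ` level X n \<subseteq> level Y n"
    by (auto simp: display_def schema_morphism_def)
  \<comment> \<open>preserving the level means preserving the number of attributes, so that \<open>f\<close>, being
    surjective onto the attributes of the image, is injective on attributes\<close>
  have "inj_on f (attrs_below X x)" if x: "x \<in> Field X" for x
  proof (rule eq_card_imp_inj_on[OF finite_attrs[OF X]])
    have "card (attrs_below X x) > 0"
      using attrs_nonempty[OF X x] finite_attrs[OF X] by (simp add: card_gt_0_iff)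
    then have "x \<in> level X (card (attrs_below X x) - 1)" using x by (simp add: level_def)
    then show "card (f ` attrs_below X x) = card (attrs_below X x)"
      using lev[of "card (attrs_below X x) - 1"] img[OF x] \<open>card (attrs_below X x) > 0\<close>
      by (auto simp: level_def)
  qed
  then show ?R using d img by (auto simp: bij_betw_def display_def schema_morphism_def)
next
  assume R: ?R
  have "(f y, f x) \<in> Y" if yx: "(y, x) \<in> X" for x y
  proof -
    have xy: "x \<in> Field X" "y \<in> Field X" using rel_Field[OF yx] by auto
    have "f ` attrs_below X y \<subseteq> f ` attrs_below X x" using attrs_mono[of X y x] R yx by blast
    then have "attrs_below Y (f y) \<subseteq> attrs_below Y (f x)" using R xy by (simp add: bij_betw_def)
    moreover have "f x \<in> Field Y" "f y \<in> Field Y" using R xy by auto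
    ultimately show ?thesis using rel_iff_attrs[of Y "f x" "f y"] R by simp
  qed
  moreover have "f ` level X n \<subseteq> level Y n" for n
    using R by (auto simp: level_def dest!: bij_betw_same_card)
  ultimately show "display X Y f"
    using R by (auto simp: bij_betw_def display_def schema_morphism_def)
qed

lemma display_Field: "display X Y f \<Longrightarrow> x \<in> Field X \<Longrightarrow> f x \<in> Field Y"
  by (auto simp: display_iff)

lemma display_ext: "display X Y f \<Longrightarrow> f \<in> extensional (Field X)"
  by (auto simp: display_iff PiE_def)

lemma display_attrs: "display X Y f \<Longrightarrow> x \<in> Field X \<Longrightarrow> bij_betw f (attrs_below X x) (attrs_below Y (f x))"
  by (auto simp: display_iff)

lemma display_attr:
  "display X Y f \<Longrightarrow> A \<in> attrs_below X x \<Longrightarrow> f A \<in> attrs_below Y (f x)"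
  using display_attrs attrs_Field bij_betwE by metis

lemma display_rel: "display X Y f \<Longrightarrow> (y, x) \<in> X \<Longrightarrow> (f y, f x) \<in> Y"
  by (simp add: display_def schema_morphism_def)

lemma display_schema: "display X Y f \<Longrightarrow> schema X \<and> schema Y"
  by (simp add: display_iff)

lemma comp_sub_apply: "x \<in> Field X \<Longrightarrow> comp_sub X g f x = g (f x)"
  by (simp add: comp_sub_def compose_def)

lemma display_comp:
  assumes "display X Y f" "display Y Z g"
  shows "display X Z (comp_sub X g f)"
proof -
  have "bij_betw (comp_sub X g f) (attrs_below X x) (attrs_below Z (comp_sub X g f x))"
    if x: "x \<in> Field X" for x
  proof -
    have "bij_betw (g \<circ> f) (attrs_below X x) (attrs_below Z (g (f x)))"
      using display_attrs[OF assms(1) x] display_attrs[OF assms(2) display_Field[OF assms(1) x]]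
      by (rule bij_betw_trans)
    moreover have "bij_betw (comp_sub X g f) (attrs_below X x) S \<longleftrightarrow> bij_betw (g \<circ> f) (attrs_below X x) S"
      for S
      by (rule bij_betw_cong) (auto simp: comp_sub_apply dest: attrs_Field)
    ultimately show ?thesis using x by (simp add: comp_sub_apply)
  qed
  moreover have "comp_sub X g f \<in> Field X \<rightarrow>\<^sub>E Field Z"
    using assms by (auto simp: comp_sub_apply display_Field) (simp add: comp_sub_def compose_def)
  ultimately show ?thesis using assms by (simp add: display_iff)
qed

lemma display_id: "schema X \<Longrightarrow> display X X (id_sub X)"
  unfolding display_iff id_sub_def
  by (auto simp: bij_betw_def inj_on_def image_def dest: attrs_Field)

lemma comp_sub_assoc:
  "display X Y f \<Longrightarrow> comp_sub X (comp_sub Y h g) f = comp_sub X h (comp_sub X g f)"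
  by (rule extensionalityI[where A = "Field X"])
    (simp_all add: comp_sub_apply display_Field, simp_all add: comp_sub_def compose_def)

lemma comp_sub_id_left: "display X Y f \<Longrightarrow> comp_sub X (id_sub Y) f = f"
  by (rule extensionalityI[where A = "Field X"])
    (simp_all add: comp_sub_apply display_Field display_ext id_sub_def, simp add: comp_sub_def compose_def)

lemma comp_sub_id_right: "display X Y f \<Longrightarrow> comp_sub X f (id_sub X) = f"
  by (rule extensionalityI[where A = "Field X"])
    (simp_all add: comp_sub_apply display_ext id_sub_def, simp add: comp_sub_def compose_def)

text \<open>
  A display morphism restricts to an isomorphism from the elements below \<open>x\<close> to those below
  \<open>f x\<close>, because both sides are the nonempty subsets of the attributes. This lemma gives
  surjectivity, the next one injectivity.
\<close>

lemma display_below: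
  assumes f: "display X Y f" and x: "x \<in> Field X" and z: "(z, f x) \<in> Y"
  obtains y where "(y, x) \<in> X" "f y = z"
proof -
  note X = conjunct1[OF display_schema[OF f]] and Y = conjunct2[OF display_schema[OF f]]
  \<comment> \<open>the face of \<open>x\<close> spanned by the attributes that \<open>f\<close> sends below \<open>z\<close>\<close>
  let ?S = "{A \<in> attrs_below X x. f A \<in> attrs_below Y z}"
  have sub: "attrs_below Y z \<subseteq> f ` attrs_below X x"
    using attrs_mono[OF Y z] display_attrs[OF f x] by (simp add: bij_betw_def)
  then have img: "f ` ?S = attrs_below Y z" by auto
  have "?S \<noteq> {}"
  proof
    assume "?S = {}"
    then have "f ` ?S = {}" by (simp only: image_empty)
    then show False using img attrs_nonempty[OF Y] rel_Field[OF z] by simp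
  qed
  then obtain y where y: "y \<in> Field X" "attrs_below X y = ?S" "(y, x) \<in> X"
    using face_exists[OF X x, of ?S] by auto
  have "attrs_below Y (f y) = attrs_below Y z"
    using display_attrs[OF f y(1)] y(2) img by (simp add: bij_betw_def)
  then have "f y = z"
    using attrs_inject[OF Y display_Field[OF f y(1)]] rel_Field[OF z] by simp
  with y(3) show ?thesis by (rule that)
qed

lemma display_inj_below:
  assumes f: "display X Y f" and y: "(y, x) \<in> X" "(z, x) \<in> X" and eq: "f y = f z"
  shows "y = z"
proof -
  note X = conjunct1[OF display_schema[OF f]]
  have "f ` attrs_below X y = f ` attrs_below X z"
    using display_attrs[OF f] y rel_Field eq by (metis bij_betw_imp_surj_on)
  then have "attrs_below X y = attrs_below X z"
    using display_attrs[OF f] rel_Field[OF y(1)] attrs_mono[OF X y(1)] attrs_mono[OF X y(2)]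
    by (metis bij_betw_imp_inj_on inj_on_image_eq_iff)
  then show ?thesis using attrs_inject[OF X] rel_Field y by metis
qed


section \<open>Instances and tuplification\<close>

lemma proj_ext [simp]: "proj X y k \<in> extensional (attrs_below X y)"
  by (simp add: proj_def)

lemma proj_apply: "A \<in> attrs_below X y \<Longrightarrow> proj X y k A = k A"
  by (simp add: proj_def)

lemma proj_id: "k \<in> extensional (attrs_below X x) \<Longrightarrow> proj X x k = k"
  by (simp add: proj_def extensional_restrict)

lemma proj_proj: "schema X \<Longrightarrow> (z, y) \<in> X \<Longrightarrow> proj X z (proj X y k) = proj X z k"
  using attrs_mono[of X z y] by (auto simp: proj_def restrict_def fun_eq_iff)

text \<open>
  For sets of tuples the functor laws and joint injectivity of the restriction maps hold
  automatically, restriction of functions being functorial and a function being determined by its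
  values. What remains is closure of the sets under restriction.
\<close>

lemma is_inst_iff:
  "is_inst X J \<longleftrightarrow> schema X \<and> J \<in> extensional (Field X) \<and>
     (\<forall>x\<in>Field X. finite (J x) \<and> J x \<subseteq> extensional (attrs_below X x)) \<and>
     (\<forall>x y. (y, x) \<in> X \<longrightarrow> proj X y ` J x \<subseteq> J y)"
  (is "_ \<longleftrightarrow> ?R")
proof
  assume "is_inst X J"
  then show ?R
    unfolding is_inst_def relational_instance_def by (fastforce simp: PiE_def)
next
  assume R: ?R
  then have X: "schema X" by simp
  have pm: "proj X y k \<in> J y" if "(y, x) \<in> X" "k \<in> J x" for x y k using R that by blast
  have e: "k \<in> extensional (attrs_below X x)" if "x \<in> Field X" "k \<in> J x" for x k using R that by blast
  have "k = l" if x: "x \<in> Field X" "k \<in> J x" "l \<in> J x"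
    and "\<forall>A\<in>attrs_below X x. proj X A k = proj X A l" for x k l
  proof (rule extensionalityI[OF e[OF x(1,2)] e[OF x(1,3)]])
    fix A assume "A \<in> attrs_below X x"
    then show "k A = l A" using that(4) proj_apply[of A X A] attrs_attr_below[OF X] by (metis singletonI)
  qed
  moreover have "k A \<in> vals J A" if "x \<in> Field X" "k \<in> J x" "A \<in> attrs_below X x" for x k A
    unfolding vals_def
  proof (rule image_eqI)
    show "proj X A k \<in> J A" using pm[OF attrs_rel[OF that(3)] that(2)] .
    show "k A = proj X A k A" by (simp add: proj_apply attrs_attr_below[OF X that(3)])
  qed
  ultimately show "is_inst X J"
    unfolding is_inst_def relational_instance_def PiE_def Pi_iff
    using R pm e proj_id[OF e] proj_proj[OF X] by (auto 0 3)
qed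

lemma inst_schema: "is_inst X J \<Longrightarrow> schema X" by (simp add: is_inst_iff)

lemma inst_finite: "is_inst X J \<Longrightarrow> x \<in> Field X \<Longrightarrow> finite (J x)" by (simp add: is_inst_iff)

lemma inst_ext: "is_inst X J \<Longrightarrow> x \<in> Field X \<Longrightarrow> k \<in> J x \<Longrightarrow> k \<in> extensional (attrs_below X x)"
  by (auto simp: is_inst_iff)

lemma inst_proj: "is_inst X J \<Longrightarrow> (y, x) \<in> X \<Longrightarrow> k \<in> J x \<Longrightarrow> proj X y k \<in> J y"
  by (simp add: is_inst_iff image_subset_iff)

lemma inst_extensional: "is_inst X J \<Longrightarrow> J \<in> extensional (Field X)" by (simp add: is_inst_iff)

lemma tuple_eqI:
  assumes "schema X" "k \<in> extensional (attrs_below X x)" "l \<in> extensional (attrs_below X x)"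
    and "\<And>A. A \<in> attrs_below X x \<Longrightarrow> proj X A k = proj X A l"
  shows "k = l"
proof (rule extensionalityI[OF assms(2,3)])
  fix A assume A: "A \<in> attrs_below X x"
  then have "proj X A k A = proj X A l A" using assms(4) by simp
  then show "k A = l A" by (simp add: proj_apply attrs_attr_below[OF assms(1) A])
qed

text \<open>
  Tuples at an attribute have a single entry.
\<close>

lemma attr_tuple_eqI:
  assumes J: "is_inst X J" and A: "A \<in> basis X" and k: "k \<in> J A" "l \<in> J A" and eq: "k A = l A"
  shows "k = l"
proof -
  note X = inst_schema[OF J]
  have "A \<in> Field X" using basis_Field[OF X] A by auto
  from inst_ext[OF J this] k have "k \<in> extensional {A}" "l \<in> extensional {A}"
    using attrs_attr[OF X A] by auto
  then show ?thesis by (rule extensionalityI) (simp add: eq)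
qed

lemma proj_tup:
  assumes R: "relational_instance X I R" and yx: "(y, x) \<in> X" and k: "k \<in> I x"
  shows "proj X y (tup X e R x k) = tup X e R y (R x y k)"
proof
  fix A
  have X: "schema X" using R by (simp add: relational_instance_def)
  show "proj X y (tup X e R x k) A = tup X e R y (R x y k) A"
  proof (cases "A \<in> attrs_below X y")
    case True
    then have "R y A (R x y k) = R x A k" using R yx k by (auto simp: relational_instance_def dest: attrs_rel)
    then show ?thesis using True attrs_mono[OF X yx] by (auto simp: proj_def tup_def)
  qed (simp add: proj_def tup_def)
qed

text \<open>
  Tuplification commutes with restriction, so its image is closed under restriction.
\<close>

lemma tuplify_is_inst:
  assumes R: "relational_instance X I R"
  shows "is_inst X (tuplify X e I R)"
  unfolding is_inst_iff
proof (intro conjI ballI allI impI)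
  show "schema X" using R by (simp add: relational_instance_def)
  show "tuplify X e I R \<in> extensional (Field X)" by (simp add: tuplify_def)
next
  fix x assume "x \<in> Field X"
  then show "finite (tuplify X e I R x)"  "tuplify X e I R x \<subseteq> extensional (attrs_below X x)"
    using R by (auto simp: tuplify_def relational_instance_def tup_def)
next
  fix x y assume yx: "(y, x) \<in> X"
  then have "R x y k \<in> I y" if "k \<in> I x" for k
    using that R by (auto simp: relational_instance_def)
  then show "proj X y ` tuplify X e I R x \<subseteq> tuplify X e I R y"
    using rel_Field[OF yx] proj_tup[OF R yx] by (auto simp: tuplify_def)
qed

lemma tup_inj:
  assumes R: "relational_instance X I R" and e: "\<And>A. A \<in> basis X \<Longrightarrow> inj_on (e A) (I A)"
    and x: "x \<in> Field X"
  shows "inj_on (tup X e R x) (I x)"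
proof (rule inj_onI)
  fix k l assume kl: "k \<in> I x" "l \<in> I x" "tup X e R x k = tup X e R x l"
  have "R x A k = R x A l" if A: "A \<in> attrs_below X x" for A
  proof (rule inj_onD[OF e[OF attr_in_basis[OF A]]])
    show "e A (R x A k) = e A (R x A l)" using fun_cong[OF kl(3), of A] A by (simp add: tup_def)
    show "R x A k \<in> I A" "R x A l \<in> I A"
      using R kl attrs_rel[OF A] by (auto simp: relational_instance_def)
  qed
  then show "k = l" using R x kl by (auto simp: relational_instance_def)
qed

text \<open>
  The inverse on the image: \<open>tup\<close> is injective because the restriction maps to the attributes are
  jointly injective.
\<close>

lemma untup_tup:
  assumes "relational_instance X I R" "\<And>A. A \<in> basis X \<Longrightarrow> inj_on (e A) (I A)"
    and "x \<in> Field X" "k \<in> I x"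
  shows "untup X e I R x (tup X e R x k) = k"
  unfolding untup_def using inv_into_f_f[OF tup_inj[OF assms(1,2,3)] assms(4)] by blast


section \<open>The schema of elements\<close>

text \<open>
  An element \<open>(y, b)\<close> is below \<open>(x, a)\<close> exactly if \<open>y \<le> x\<close> and \<open>b\<close> is the restriction of
  \<open>a\<close>; since tuples are determined by their entries, this is inclusion of the sets of tagged
  entries. A face of \<open>(x, a)\<close> is obtained by restricting \<open>a\<close> to the corresponding face of
  \<open>x\<close>.
\<close>

lemma
  fixes X :: "'x rel" and J :: "'x \<Rightarrow> ('x \<Rightarrow> 'v) set"
  assumes J: "is_inst X J"
  shows elts_schema: "schema (elts X J)"
    and elts_Field: "Field (elts X J) = Sigma (Field X) J"
    and elts_attrs: "\<And>x a. x \<in> Field X \<Longrightarrow> a \<in> J x \<Longrightarrow>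
      attrs_below (elts X J) (x, a) = (\<lambda>A. (A, proj X A a)) ` attrs_below X x"
    and elts_basis: "basis (elts X J) = Sigma (basis X) J"
proof -
  note X = inst_schema[OF J]
  \<comment> \<open>the attributes below \<open>(x, a)\<close> are the entries of the tuple \<open>a\<close>, tagged with their index\<close>
  define att :: "'x \<times> ('x \<Rightarrow> 'v) \<Rightarrow> ('x \<times> ('x \<Rightarrow> 'v)) set" where "att p = (\<lambda>A. (A, proj X A (snd p))) ` attrs_below X (fst p)" for p
  have order: "(q, p) \<in> elts X J \<longleftrightarrow> q \<in> Sigma (Field X) J \<and> p \<in> Sigma (Field X) J \<and> att q \<subseteq> att p"
    for p q
  proof -
    obtain x a y b where p: "p = (x, a)" and q: "q = (y, b)" by fastforce
    show ?thesis
    proof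
      assume "(q, p) \<in> elts X J"
      then have *: "(y, x) \<in> X" "a \<in> J x" "b \<in> J y" "b = proj X y a" by (auto simp: elts_def p q)
      have "(A, proj X A b) \<in> att p" if A: "A \<in> attrs_below X y" for A
        using attrs_mono[OF X *(1)] A proj_proj[OF X attrs_rel[OF A], of a]
        by (auto simp: att_def p *(4))
      then show "q \<in> Sigma (Field X) J \<and> p \<in> Sigma (Field X) J \<and> att q \<subseteq> att p"
        using * rel_Field[OF *(1)] by (auto simp: p q att_def)
    next
      assume "q \<in> Sigma (Field X) J \<and> p \<in> Sigma (Field X) J \<and> att q \<subseteq> att p"
      then have *: "x \<in> Field X" "a \<in> J x" "y \<in> Field X" "b \<in> J y" and sub: "att q \<subseteq> att p"
        by (auto simp: p q)
      have s: "A \<in> attrs_below X x \<and> proj X A b = proj X A a" if "A \<in> attrs_below X y" for A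
        using that sub by (auto simp: att_def p q)
      then have yx: "(y, x) \<in> X" using rel_iff_attrs[OF X *(1,3)] by blast
      have "proj X y a = b"
        by (rule tuple_eqI[OF X _ inst_ext[OF J *(3,4)]])
          (simp_all add: s proj_proj[OF X attrs_rel])
      then show "(q, p) \<in> elts X J" using * yx by (simp add: elts_def p q)
    qed
  qed
  have inj: "p = q" if "p \<in> Sigma (Field X) J" "q \<in> Sigma (Field X) J" "att p = att q" for p q
  proof -
    have "(p, q) \<in> elts X J" "(q, p) \<in> elts X J" using order that by auto
    then have "(fst p, fst q) \<in> X" "(fst q, fst p) \<in> X" "snd p = proj X (fst p) (snd q)"
      by (auto simp: elts_def)
    moreover from this have "fst p = fst q" using schema_antisym[OF X] by blast
    ultimately show ?thesis
      using proj_id[OF inst_ext[OF J, of "fst q" "snd q"]] that(2) by (auto simp: prod_eq_iff)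
  qed
  have fin: "finite (Sigma (Field X) J)"
    using schema_finite[OF X] inst_finite[OF J] by blast
  have attp: "att p \<noteq> {} \<and> att p \<subseteq> Sigma (basis X) J" if "p \<in> Sigma (Field X) J" for p
    using that attrs_nonempty[OF X] inst_proj[OF J attrs_rel]
    by (auto simp: att_def dest: attr_in_basis)
  have B: "Sigma (basis X) J \<subseteq> Sigma (Field X) J" using basis_Field[OF X] by auto
  have attb: "att b = {b}" if "b \<in> Sigma (basis X) J" for b
    using that attrs_attr[OF X, of "fst b"] inst_ext[OF J, of "fst b" "snd b"] basis_Field[OF X]
    by (auto simp: att_def proj_id)
  have sub: "\<exists>q\<in>Sigma (Field X) J. att q = Y"
    if p: "p \<in> Sigma (Field X) J" and Y: "Y \<noteq> {}" "Y \<subseteq> att p" for p Y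
  proof -
    obtain x a where p': "p = (x, a)" "x \<in> Field X" "a \<in> J x" using p by auto
    have Y': "Y = (\<lambda>A. (A, proj X A a)) ` (fst ` Y)" "fst ` Y \<subseteq> attrs_below X x"
      using Y(2) by (force simp: att_def p'(1))+
    obtain y where y: "y \<in> Field X" "attrs_below X y = fst ` Y" "(y, x) \<in> X"
      using face_exists[OF X p'(2), of "fst ` Y"] Y(1) Y'(2) by auto
    have "att (y, proj X y a) = (\<lambda>A. (A, proj X A a)) ` attrs_below X y"
      unfolding att_def by (rule image_cong) (simp_all add: proj_proj[OF X attrs_rel])
    also have "\<dots> = Y" using y(2) Y'(1) by simp
    finally show ?thesis using y inst_proj[OF J y(3) p'(3)] by blast
  qed
  have all: "schema (elts X J) \<and> Field (elts X J) = Sigma (Field X) J \<and>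
      basis (elts X J) = Sigma (basis X) J \<and>
      (\<forall>p\<in>Sigma (Field X) J. attrs_below (elts X J) p = att p)"
    by (rule schema_of_attributes) (fact fin order inj attp B attb sub)+
  then show "schema (elts X J)" "Field (elts X J) = Sigma (Field X) J"
    "basis (elts X J) = Sigma (basis X) J"
    by simp_all
  show "attrs_below (elts X J) (x, a) = (\<lambda>A. (A, proj X A a)) ` attrs_below X x"
    if "x \<in> Field X" "a \<in> J x" for x a
    using all that by (simp add: att_def)
qed

lemma elts_relD: "((y, b), (x, a)) \<in> elts X J \<Longrightarrow> (y, x) \<in> X \<and> a \<in> J x \<and> b \<in> J y \<and> proj X y a = b"
  by (simp add: elts_def)

lemma down_apply: "p \<in> Field (elts X J) \<Longrightarrow> down X J p = fst p"
  by (auto simp: down_def split: prod.split)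

lemma display_down:
  assumes J: "is_inst X J"
  shows "display (elts X J) X (down X J)"
proof -
  have "bij_betw (down X J) (attrs_below (elts X J) p) (attrs_below X (down X J p))"
    if p: "p \<in> Field (elts X J)" for p
  proof -
    have "down X J q = fst q" if "q \<in> attrs_below (elts X J) p" for q
      using attrs_Field[OF that] by (simp add: down_apply)
    moreover have "bij_betw fst (attrs_below (elts X J) p) (attrs_below X (fst p))"
      using p elts_attrs[OF J] by (auto simp: elts_Field[OF J] bij_betw_def inj_on_def image_image)
    ultimately show ?thesis
      unfolding down_apply[OF p] by (subst bij_betw_cong[where g = fst]) simp_all
  qed
  moreover have "down X J \<in> Field (elts X J) \<rightarrow>\<^sub>E Field X"
  proof (rule PiE_I)
    show "down X J p \<in> Field X" if "p \<in> Field (elts X J)" for p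
      using that by (auto simp: down_apply elts_Field[OF J])
    show "down X J p = undefined" if "p \<notin> Field (elts X J)" for p
      using that by (simp add: down_def)
  qed
  ultimately show ?thesis
    using elts_schema[OF J] inst_schema[OF J] by (simp add: display_iff)
qed


section \<open>Substitution in instances\<close>

lemma reindex_ext [simp]: "reindex X f x k \<in> extensional (attrs_below X x)"
  by (simp add: reindex_def)

lemma reindex_apply: "A \<in> attrs_below X x \<Longrightarrow> reindex X f x k A = k (f A)"
  by (simp add: reindex_def)

lemma reindex_cong:
  "(\<And>A. A \<in> attrs_below X x \<Longrightarrow> f A = g A) \<Longrightarrow> reindex X f x k = reindex X g x k"
  by (auto simp: reindex_def restrict_def fun_eq_iff)

lemma reindex_reindex:
  assumes "display X Y f" "x \<in> Field X"
  shows "reindex X f x (reindex Y g (f x) k) = reindex X (comp_sub X g f) x k"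
  using display_attr[OF assms(1)] attrs_Field
  by (fastforce simp: reindex_def restrict_def fun_eq_iff comp_sub_apply)

lemma reindex_id:
  "k \<in> extensional (attrs_below X x) \<Longrightarrow> reindex X (id_sub X) x k = k"
  by (rule extensionalityI[where A = "attrs_below X x"])
    (auto simp: reindex_apply id_sub_def dest: attrs_Field)

lemma unreindex_reindex:
  assumes "display X Y f" "x \<in> Field X" "k \<in> extensional (attrs_below Y (f x))"
  shows "unreindex X Y f x (reindex X f x k) = k"
proof (rule extensionalityI[where A = "attrs_below Y (f x)"])
  fix B assume B: "B \<in> attrs_below Y (f x)"
  then have "inv_into (attrs_below X x) f B \<in> attrs_below X x" "f (inv_into (attrs_below X x) f B) = B"
    using display_attrs[OF assms(1,2)]
    by (auto simp: bij_betw_def f_inv_into_f inv_into_into)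
  then show "unreindex X Y f x (reindex X f x k) B = k B"
    using B by (simp add: unreindex_def reindex_def)
qed (use assms in \<open>auto simp: unreindex_def\<close>)

lemma reindex_unreindex:
  assumes "display X Y f" "x \<in> Field X" "k \<in> extensional (attrs_below X x)"
  shows "reindex X f x (unreindex X Y f x k) = k"
proof (rule extensionalityI[where A = "attrs_below X x"])
  fix A assume "A \<in> attrs_below X x"
  then show "reindex X f x (unreindex X Y f x k) A = k A"
    using display_attrs[OF assms(1,2)] display_attr[OF assms(1)]
    by (auto simp: unreindex_def reindex_def bij_betw_def)
qed (use assms in auto)

lemma proj_reindex:
  assumes "display X Y f" "(y, x) \<in> X"
  shows "proj X y (reindex X f x k) = reindex X f y (proj Y (f y) k)"
  using attrs_mono[OF _ assms(2)] display_schema[OF assms(1)] display_attr[OF assms(1)]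
  by (fastforce simp: proj_def reindex_def restrict_def fun_eq_iff)

lemma inst_sub_apply: "x \<in> Field X \<Longrightarrow> inst_sub X f J x = reindex X f x ` J (f x)"
  by (simp add: inst_sub_def)

lemma inst_sub_is_inst:
  assumes f: "display X Y f" and J: "is_inst Y J"
  shows "is_inst X (inst_sub X f J)"
  unfolding is_inst_iff
proof (intro conjI ballI allI impI)
  show "schema X" using display_schema[OF f] by simp
  show "inst_sub X f J \<in> extensional (Field X)" by (simp add: inst_sub_def)
next
  fix x assume "x \<in> Field X"
  then show "finite (inst_sub X f J x)" "inst_sub X f J x \<subseteq> extensional (attrs_below X x)"
    using inst_finite[OF J display_Field[OF f]] by (auto simp: inst_sub_apply)
next
  fix x y assume yx: "(y, x) \<in> X"
  then show "proj X y ` inst_sub X f J x \<subseteq> inst_sub X f J y"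
    using inst_proj[OF J display_rel[OF f yx]] rel_Field[OF yx]
    by (auto simp: inst_sub_apply proj_reindex[OF f])
qed

lemma inst_sub_comp:
  assumes f: "display X Y f" and g: "display Y Z g"
  shows "inst_sub X (comp_sub X g f) J = inst_sub X f (inst_sub Y g J)"
proof (rule extensionalityI[where A = "Field X"])
  fix x assume x: "x \<in> Field X"
  then show "inst_sub X (comp_sub X g f) J x = inst_sub X f (inst_sub Y g J) x"
    by (simp add: inst_sub_apply display_Field[OF f] image_image reindex_reindex[OF f]
        comp_sub_apply)
qed (simp_all add: inst_sub_def)

lemma inst_sub_id:
  assumes J: "is_inst X J"
  shows "inst_sub X (id_sub X) J = J"
proof (rule extensionalityI[OF _ inst_extensional[OF J]])
  fix x assume x: "x \<in> Field X"
  have "reindex X (id_sub X) x ` J x = id ` J x"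
    by (rule image_cong) (simp_all add: reindex_id inst_ext[OF J x])
  then show "inst_sub X (id_sub X) J x = J x"
    using x by (simp add: inst_sub_apply id_sub_def)
qed (simp add: inst_sub_def)

lemma unreindex_mem:
  assumes f: "display X Y f" and J: "is_inst Y J" and x: "x \<in> Field X" and a: "a \<in> inst_sub X f J x"
  shows "unreindex X Y f x a \<in> J (f x)"
  using a x by (auto simp: inst_sub_apply unreindex_reindex[OF f x] inst_ext[OF J display_Field[OF f x]])

lemma proj_unreindex:
  assumes f: "display X Y f" and yx: "(y, x) \<in> X" and k: "k \<in> extensional (attrs_below X x)"
  shows "proj Y (f y) (unreindex X Y f x k) = unreindex X Y f y (proj X y k)"
proof -
  have "proj X y k = reindex X f y (proj Y (f y) (unreindex X Y f x k))"
    using proj_reindex[OF f yx] reindex_unreindex[OF f _ k] rel_Field[OF yx] by metis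
  then show ?thesis using rel_Field[OF yx] by (simp add: unreindex_reindex[OF f])
qed


section \<open>Full tuples and context extension\<close>

text \<open>
  The data of a full tuple of \<open>J[f]\<close> before reindexing: elements of \<open>J (f x)\<close> that are compatible
  with restriction. Equivalently, the second components of a lift of \<open>f\<close> to the schema of elements
  of \<open>J\<close>. Stating it with tuples still indexed by attributes of \<open>Y\<close> separates these two readings
  from the bookkeeping of index sets.
\<close>

definition section_along ::
    "'x rel \<Rightarrow> 'y rel \<Rightarrow> ('x \<Rightarrow> 'y) \<Rightarrow> ('y \<Rightarrow> ('y \<Rightarrow> 'v) set) \<Rightarrow> ('x \<Rightarrow> 'y \<Rightarrow> 'v) \<Rightarrow> bool" where
  "section_along X Y f J g \<longleftrightarrow> display X Y f \<and> is_inst Y J \<and> (\<forall>x\<in>Field X. g x \<in> J (f x)) \<and>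
     (\<forall>x y. (y, x) \<in> X \<longrightarrow> proj Y (f y) (g x) = g y)"

lemma section_trm:
  assumes "section_along X Y f J g"
  shows "is_trm X (inst_sub X f J) (\<lambda>x\<in>Field X. reindex X f x (g x))"
proof -
  have f: "display X Y f" and J: "is_inst Y J" and g: "\<And>x. x \<in> Field X \<Longrightarrow> g x \<in> J (f x)"
    and n: "\<And>x y. (y, x) \<in> X \<Longrightarrow> proj Y (f y) (g x) = g y"
    using assms by (auto simp: section_along_def)
  show ?thesis
    unfolding is_trm_def
  proof (intro conjI allI impI)
    show "is_inst X (inst_sub X f J)" by (rule inst_sub_is_inst[OF f J])
    show "(\<lambda>x\<in>Field X. reindex X f x (g x)) \<in> (\<Pi>\<^sub>E x\<in>Field X. inst_sub X f J x)"
      by (auto simp: inst_sub_apply g)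
  next
    fix x y assume yx: "(y, x) \<in> X"
    then show "proj X y ((\<lambda>x\<in>Field X. reindex X f x (g x)) x) = (\<lambda>x\<in>Field X. reindex X f x (g x)) y"
      using rel_Field[OF yx] by (simp add: proj_reindex[OF f yx] n)
  qed
qed

text \<open>
  The universal property of context extension: morphisms into \<open>\<Gamma>.A\<close> are morphisms into
  \<open>\<Gamma>\<close> with a section. The morphisms \<open>hat\<close> and \<open>tilde\<close> and the points at which eliminators
  compute are all of this form.
\<close>

lemma section_display:
  assumes "section_along X Y f J g"
  shows "display X (elts Y J) (\<lambda>x\<in>Field X. (f x, g x))"
proof -
  have f: "display X Y f" and J: "is_inst Y J" and g: "\<And>x. x \<in> Field X \<Longrightarrow> g x \<in> J (f x)"
    and n: "\<And>x y. (y, x) \<in> X \<Longrightarrow> proj Y (f y) (g x) = g y"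
    using assms by (auto simp: section_along_def)
  have "bij_betw (\<lambda>x\<in>Field X. (f x, g x)) (attrs_below X x) (attrs_below (elts Y J) (f x, g x))"
    if x: "x \<in> Field X" for x
  proof -
    have "bij_betw (\<lambda>x. (f x, g x)) (attrs_below X x) (attrs_below (elts Y J) (f x, g x))"
    proof (rule bij_betw_imageI)
      show "inj_on (\<lambda>x. (f x, g x)) (attrs_below X x)"
        using display_attrs[OF f x] by (auto simp: bij_betw_def inj_on_def)
      have "attrs_below (elts Y J) (f x, g x) = (\<lambda>B. (B, proj Y B (g x))) ` f ` attrs_below X x"
        using elts_attrs[OF J display_Field[OF f x] g[OF x]] display_attrs[OF f x]
        by (simp add: bij_betw_def)
      also have "\<dots> = (\<lambda>x. (f x, g x)) ` attrs_below X x"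
        unfolding image_image by (rule image_cong) (simp_all add: n attrs_rel)
      finally show "(\<lambda>x. (f x, g x)) ` attrs_below X x = attrs_below (elts Y J) (f x, g x)" ..
    qed
    then show ?thesis
      by (subst bij_betw_cong[where g = "\<lambda>x. (f x, g x)"]) (auto dest: attrs_Field)
  qed
  moreover have "(\<lambda>x\<in>Field X. (f x, g x)) \<in> Field X \<rightarrow>\<^sub>E Field (elts Y J)"
    using g display_Field[OF f] by (auto simp: elts_Field[OF J])
  ultimately show ?thesis
    using display_schema[OF f] elts_schema[OF J] by (simp add: display_iff)
qed

lemma section_Field:
  assumes "section_along X Y f J g" "x \<in> Field X"
  shows "(f x, g x) \<in> Field (elts Y J)"
  using display_Field[OF section_display[OF assms(1)] assms(2)] assms(2) by simp

lemma trm_mem: "is_trm X J t \<Longrightarrow> x \<in> Field X \<Longrightarrow> t x \<in> J x"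
  by (auto simp: is_trm_def)

lemma trm_proj: "is_trm X J t \<Longrightarrow> (y, x) \<in> X \<Longrightarrow> proj X y (t x) = t y"
  by (simp add: is_trm_def)

lemma trm_inst: "is_trm X J t \<Longrightarrow> is_inst X J"
  by (simp add: is_trm_def)

lemma trm_extensional: "is_trm X J t \<Longrightarrow> t \<in> extensional (Field X)"
  by (auto simp: is_trm_def PiE_def)

lemma trm_ext: "is_trm X J t \<Longrightarrow> x \<in> Field X \<Longrightarrow> t x \<in> extensional (attrs_below X x)"
  using trm_mem inst_ext trm_inst by metis

lemma section_trm_sub:
  assumes "display X Y f" "is_trm Y J t"
  shows "section_along X Y f J (\<lambda>x. t (f x))"
  using assms trm_mem[OF assms(2)] trm_proj[OF assms(2)] trm_inst[OF assms(2)]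
    display_Field[OF assms(1)] display_rel[OF assms(1)]
  by (simp add: section_along_def)

lemma trm_sub_is_trm:
  assumes "display X Y f" "is_trm Y J t"
  shows "is_trm X (inst_sub X f J) (trm_sub X f t)"
  using section_trm[OF section_trm_sub[OF assms]] by (simp add: trm_sub_def)

lemma trm_sub_comp:
  assumes f: "display X Y f"
  shows "trm_sub X (comp_sub X g f) t = trm_sub X f (trm_sub Y g t)"
  by (rule extensionalityI[where A = "Field X"])
    (simp_all add: trm_sub_def display_Field[OF f] reindex_reindex[OF f] comp_sub_apply)

lemma trm_sub_id:
  assumes t: "is_trm X J t"
  shows "trm_sub X (id_sub X) t = t"
  by (rule extensionalityI[OF _ trm_extensional[OF t]])
    (simp_all add: trm_sub_def id_sub_def[of X, THEN fun_cong] reindex_id trm_ext[OF t])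

lemma hat_apply: "x \<in> Field X \<Longrightarrow> hat X t x = (x, t x)"
  by (simp add: hat_def)

lemma display_hat:
  assumes t: "is_trm X J t"
  shows "display X (elts X J) (hat X t)"
proof -
  have "section_along X X (id_sub X) J (\<lambda>x. t (id_sub X x))"
    using section_trm_sub[OF display_id t] inst_schema[OF trm_inst[OF t]] by blast
  from section_display[OF this] show ?thesis
    unfolding hat_def by (rule back_subst[of "display X (elts X J)"]) (auto simp: id_sub_def)
qed

lemma down_hat:
  assumes a: "is_trm X J a"
  shows "comp_sub X (down X J) (hat X a) = id_sub X"
proof (rule extensionalityI[where A = "Field X"])
  fix x assume x: "x \<in> Field X"
  then show "comp_sub X (down X J) (hat X a) x = id_sub X x"
    using display_Field[OF display_hat[OF a] x]
    by (simp add: comp_sub_apply hat_apply down_apply id_sub_def)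
qed (simp_all add: comp_sub_def compose_def id_sub_def)

lemma section_var:
  assumes J: "is_inst X J"
  shows "section_along (elts X J) X (down X J) J snd"
  unfolding section_along_def
proof (intro conjI ballI allI impI)
  fix p q assume qp: "(q, p) \<in> elts X J"
  then show "proj X (down X J q) (snd p) = snd q"
    using rel_Field[OF qp] by (auto simp: down_apply elts_def)
qed (use display_down[OF J] J in \<open>auto simp: elts_Field[OF J] down_apply\<close>)

lemma var_apply:
  "p \<in> Field (elts X J) \<Longrightarrow> var X J p = reindex (elts X J) (down X J) p (snd p)"
  by (auto simp: var_def split: prod.split)

lemma var_is_trm:
  assumes J: "is_inst X J"
  shows "is_trm (elts X J) (inst_sub (elts X J) (down X J) J) (var X J)"
  using section_trm[OF section_var[OF J]]
  by (rule back_subst[of "is_trm _ _"]) (auto simp: var_def)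

lemma var_hat:
  assumes a: "is_trm X J a"
  shows "trm_sub X (hat X a) (var X J) = a"
proof (rule extensionalityI[OF _ trm_extensional[OF a]])
  fix x assume x: "x \<in> Field X"
  note h = display_hat[OF a]
  have "trm_sub X (hat X a) (var X J) x = reindex X (comp_sub X (down X J) (hat X a)) x (a x)"
    using x display_Field[OF h x] reindex_reindex[OF h x, of "down X J" "a x"]
    by (simp add: trm_sub_def var_apply hat_apply)
  then show "trm_sub X (hat X a) (var X J) x = a x"
    by (simp add: down_hat[OF a] reindex_id trm_ext[OF a x])
qed (simp add: trm_sub_def)

text \<open>
  The reason why \<open>tilde\<close> is a display morphism: it is the lift of \<open>f \<circ> down\<close> whose section is the
  variable, transported back to tuples indexed by \<open>Y\<close>.
\<close>

lemma section_tilde: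
  assumes f: "display X Y f" and J: "is_inst Y J"
  shows "section_along (elts X (inst_sub X f J)) Y
    (comp_sub (elts X (inst_sub X f J)) f (down X (inst_sub X f J))) J
    (\<lambda>(x, a). unreindex X Y f x a)"
proof -
  note J' = inst_sub_is_inst[OF f J]
  show ?thesis
    unfolding section_along_def
  proof (intro conjI ballI allI impI)
    show "display (elts X (inst_sub X f J)) Y
      (comp_sub (elts X (inst_sub X f J)) f (down X (inst_sub X f J)))"
      by (rule display_comp[OF display_down[OF J'] f])
    show "is_inst Y J" by (rule J)
  next
    fix p assume "p \<in> Field (elts X (inst_sub X f J))"
    then show "(case p of (x, a) \<Rightarrow> unreindex X Y f x a)
        \<in> J (comp_sub (elts X (inst_sub X f J)) f (down X (inst_sub X f J)) p)"
      using unreindex_mem[OF f J] by (auto simp: comp_sub_apply down_apply elts_Field[OF J'])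
  next
    fix p q assume qp: "(q, p) \<in> elts X (inst_sub X f J)"
    obtain x a y b where p: "p = (x, a)" and q: "q = (y, b)" by fastforce
    have *: "(y, x) \<in> X" "a \<in> inst_sub X f J x" "proj X y a = b"
      using elts_relD[OF qp[unfolded p q]] by auto
    show "proj Y (comp_sub (elts X (inst_sub X f J)) f (down X (inst_sub X f J)) q)
        (case p of (x, a) \<Rightarrow> unreindex X Y f x a) = (case q of (x, a) \<Rightarrow> unreindex X Y f x a)"
      using rel_Field[OF qp] proj_unreindex[OF f *(1) inst_ext[OF J' _ *(2)]] rel_Field[OF *(1)] *(3)
      by (simp add: p q comp_sub_apply down_apply)
  qed
qed

lemma tilde_apply:
  "p \<in> Field (elts X (inst_sub X f J)) \<Longrightarrow>
    tilde X Y f J p = (f (fst p), unreindex X Y f (fst p) (snd p))"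
  by (auto simp: tilde_def split: prod.split)

lemma display_tilde:
  assumes f: "display X Y f" and J: "is_inst Y J"
  shows "display (elts X (inst_sub X f J)) (elts Y J) (tilde X Y f J)"
  using section_display[OF section_tilde[OF f J]]
  by (rule back_subst[of "display _ _"])
    (auto simp: tilde_def comp_sub_apply down_apply restrict_def fun_eq_iff)

lemma down_tilde:
  assumes f: "display X Y f" and J: "is_inst Y J"
  shows "comp_sub (elts X (inst_sub X f J)) (down Y J) (tilde X Y f J)
       = comp_sub (elts X (inst_sub X f J)) f (down X (inst_sub X f J))"
proof (rule extensionalityI[where A = "Field (elts X (inst_sub X f J))"])
  fix p assume p: "p \<in> Field (elts X (inst_sub X f J))"
  then show "comp_sub (elts X (inst_sub X f J)) (down Y J) (tilde X Y f J) p
       = comp_sub (elts X (inst_sub X f J)) f (down X (inst_sub X f J)) p"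
    using display_Field[OF display_tilde[OF f J] p]
    by (simp add: comp_sub_apply down_apply tilde_apply)
qed (simp_all add: comp_sub_def compose_def)

lemma var_tilde:
  assumes f: "display X Y f" and J: "is_inst Y J"
  shows "trm_sub (elts X (inst_sub X f J)) (tilde X Y f J) (var Y J) = var X (inst_sub X f J)"
proof (rule extensionalityI[where A = "Field (elts X (inst_sub X f J))"])
  note J' = inst_sub_is_inst[OF f J]
  fix p assume p: "p \<in> Field (elts X (inst_sub X f J))"
  then obtain x a where xa: "p = (x, a)" "x \<in> Field X" "a \<in> inst_sub X f J x"
    by (auto simp: elts_Field[OF J'])
  let ?E = "elts X (inst_sub X f J)"
  have "trm_sub ?E (tilde X Y f J) (var Y J) p
      = reindex ?E (comp_sub ?E (down Y J) (tilde X Y f J)) p (unreindex X Y f x a)"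
    using p display_Field[OF display_tilde[OF f J] p] reindex_reindex[OF display_tilde[OF f J] p]
    by (simp add: trm_sub_def var_apply tilde_apply xa)
  also have "\<dots> = reindex ?E (down X (inst_sub X f J)) p (reindex X f x (unreindex X Y f x a))"
    using reindex_reindex[OF display_down[OF J'] p, of f "unreindex X Y f x a"] p
    by (simp add: down_tilde[OF f J] down_apply xa(1))
  also have "\<dots> = var X (inst_sub X f J) p"
    using p by (simp add: var_apply reindex_unreindex[OF f xa(2) inst_ext[OF J' xa(2,3)]] xa(1))
  finally show "trm_sub ?E (tilde X Y f J) (var Y J) p = var X (inst_sub X f J) p" .
qed (auto simp: trm_sub_def var_def)

text \<open>
  Composing the hat of the full tuple with \<open>tilde\<close> gives back the lift of \<open>f\<close>: the reindexing in
  the full tuple is undone by the one in \<open>tilde\<close>.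
\<close>

lemma tilde_section:
  assumes s: "section_along X Y f J g" and x: "x \<in> Field X"
    and t: "\<And>x. x \<in> Field X \<Longrightarrow> t x = reindex X f x (g x)"
  shows "tilde X Y f J (hat X t x) = (f x, g x)"
proof -
  have f: "display X Y f" and J: "is_inst Y J" and g: "g x \<in> J (f x)"
    using s x by (auto simp: section_along_def)
  have "hat X t x \<in> Field (elts X (inst_sub X f J))"
    using x g by (auto simp: hat_apply t elts_Field[OF inst_sub_is_inst[OF f J]] inst_sub_apply)
  then show ?thesis
    using x unreindex_reindex[OF f x inst_ext[OF J display_Field[OF f x] g]]
    by (simp add: tilde_apply hat_apply t)
qed

lemma tilde_hat:
  assumes f: "display X Y f" and a: "is_trm Y J a"
  shows "comp_sub X (tilde X Y f J) (hat X (trm_sub X f a)) = comp_sub X (hat Y a) f"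
proof (rule extensionalityI[where A = "Field X"])
  fix x assume x: "x \<in> Field X"
  have "tilde X Y f J (hat X (trm_sub X f a) x) = (f x, a (f x))"
    by (rule tilde_section[OF section_trm_sub[OF f a] x]) (simp add: trm_sub_def)
  then show "comp_sub X (tilde X Y f J) (hat X (trm_sub X f a)) x = comp_sub X (hat Y a) f x"
    using x display_Field[OF f x] by (simp add: comp_sub_apply hat_apply)
qed (simp_all add: comp_sub_def compose_def)

lemma tilde_var:
  assumes J: "is_inst X J"
  shows "comp_sub (elts X J) (tilde (elts X J) X (down X J) J) (hat (elts X J) (var X J)) = id_sub (elts X J)"
proof (rule extensionalityI[where A = "Field (elts X J)"])
  fix p assume p: "p \<in> Field (elts X J)"
  have "tilde (elts X J) X (down X J) J (hat (elts X J) (var X J) p) = (down X J p, snd p)"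
    by (rule tilde_section[OF section_var[OF J] p var_apply])
  then show "comp_sub (elts X J) (tilde (elts X J) X (down X J) J) (hat (elts X J) (var X J)) p
      = id_sub (elts X J) p"
    using p by (simp add: comp_sub_apply down_apply id_sub_def)
qed (simp_all add: comp_sub_def compose_def id_sub_def)

lemma tilde_comp:
  assumes g: "display Y Z g" and f: "display X Y f" and J: "is_inst Z J"
  shows "comp_sub (elts X (inst_sub X f (inst_sub Y g J))) (tilde Y Z g J) (tilde X Y f (inst_sub Y g J))
     = tilde X Z (comp_sub X g f) J"
proof (rule extensionalityI[where A = "Field (elts X (inst_sub X f (inst_sub Y g J)))"])
  note J' = inst_sub_is_inst[OF g J]
  note J'' = inst_sub_is_inst[OF f J']
  note eq = inst_sub_comp[OF f g, of J]
  let ?E = "elts X (inst_sub X f (inst_sub Y g J))"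
  fix p assume p: "p \<in> Field ?E"
  then obtain x a where xa: "p = (x, a)" "x \<in> Field X" "a \<in> inst_sub X f (inst_sub Y g J) x"
    by (auto simp: elts_Field[OF J''])
  then obtain k where k: "k \<in> J (g (f x))" "a = reindex X f x (reindex Y g (f x) k)"
    using display_Field[OF f] by (auto simp: inst_sub_apply)
  have ke: "k \<in> extensional (attrs_below Z (g (f x)))"
    using inst_ext[OF J _ k(1)] display_Field f g xa(2) by metis
  have "unreindex X Z (comp_sub X g f) x a = k"
    using unreindex_reindex[OF display_comp[OF f g] xa(2)] ke xa(2)
    by (simp add: k(2) reindex_reindex[OF f xa(2)] comp_sub_apply)
  moreover have "unreindex Y Z g (f x) (unreindex X Y f x a) = k"
    using unreindex_reindex[OF g display_Field[OF f xa(2)] ke]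
    by (simp add: k(2) unreindex_reindex[OF f xa(2)])
  moreover have "p \<in> Field (elts X (inst_sub X (comp_sub X g f) J))" using p eq by simp
  ultimately show "comp_sub ?E (tilde Y Z g J) (tilde X Y f (inst_sub Y g J)) p
      = tilde X Z (comp_sub X g f) J p"
    using p display_Field[OF display_tilde[OF f J'] p]
    by (simp add: comp_sub_apply tilde_apply xa)
qed (simp add: comp_sub_def compose_def, simp add: tilde_def inst_sub_comp[OF f g])


section \<open>Introduction and elimination in general\<close>

text \<open>
  The computation rules of dependent sums, identity types and binary sums are instances of this
  lemma. An introduction term \<open>t\<close> is
  a section \<open>g\<close> along a substitution \<open>f\<close>; the substitution on the left-hand side of the rule
  amounts to reindexing along the lift \<open>h\<close> of \<open>f\<close> by \<open>g\<close>. The eliminator \<open>r\<close> was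
  defined on the image of \<open>h\<close> by the inverse reindexing, so the two cancel.
\<close>

lemma eliminator_computation:
  assumes s: "section_along X Y f J g"
    and t: "t = (\<lambda>x\<in>Field X. reindex X f x (g x))"
    and h: "\<And>x. x \<in> Field X \<Longrightarrow> h x = (f x, g x)"
    and c: "is_trm X (inst_sub X (hat X t) (inst_sub (elts X (inst_sub X f J)) (tilde X Y f J) C)) c"
    and r: "\<And>x. x \<in> Field X \<Longrightarrow> r (h x) = unreindex X (elts Y J) h x (c x)"
  shows "trm_sub X (hat X t) (trm_sub (elts X (inst_sub X f J)) (tilde X Y f J) r) = c"
proof (rule extensionalityI[OF _ trm_extensional[OF c]])
  fix x assume x: "x \<in> Field X"
  have f: "display X Y f" and J: "is_inst Y J" using s by (auto simp: section_along_def)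
  have tt: "is_trm X (inst_sub X f J) t" unfolding t by (rule section_trm[OF s])
  note dh = display_hat[OF tt]
  have th: "tilde X Y f J (hat X t x) = h x" if "x \<in> Field X" for x
    using tilde_section[OF s that, of t] h[OF that] t by simp
  define h' where "h' = (\<lambda>x\<in>Field X. (f x, g x))"
  have h': "display X (elts Y J) h'" unfolding h'_def by (rule section_display[OF s])
  have hh: "h x = h' x" if "x \<in> Field X" for x using h that by (simp add: h'_def)
  \<comment> \<open>hence reindexing along \<open>h\<close> is invertible, and it undoes \<open>unreindex\<close>\<close>
  have ih: "bij_betw h (attrs_below X x) (attrs_below (elts Y J) (h x))"
    using display_attrs[OF h' x] hh[OF x]
    by (subst bij_betw_cong[where g = h']) (auto dest: attrs_Field simp: hh)
  have "trm_sub X (hat X t) (trm_sub (elts X (inst_sub X f J)) (tilde X Y f J) r) x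
     = reindex X (comp_sub X (tilde X Y f J) (hat X t)) x (r (h x))"
    using x display_Field[OF dh x] reindex_reindex[OF dh x] by (simp add: trm_sub_def th)
  also have "\<dots> = reindex X h x (r (h x))"
    by (rule reindex_cong) (auto simp: comp_sub_apply th dest: attrs_Field)
  also have "\<dots> = c x"
  proof (rule extensionalityI[OF _ trm_ext[OF c x]])
    fix A assume A: "A \<in> attrs_below X x"
    then have "h A \<in> attrs_below (elts Y J) (h x)" using ih by (auto simp: bij_betw_def)
    then show "reindex X h x (r (h x)) A = c x A"
      using A ih by (simp add: reindex_apply r[OF x] unreindex_def bij_betw_def)
  qed simp
  finally show "trm_sub X (hat X t) (trm_sub (elts X (inst_sub X f J)) (tilde X Y f J) r) x = c x" .
qed (simp add: trm_sub_def)

text \<open>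
  Introduction terms are given by elements of the instances before tuplification; naturality can be
  checked there.
\<close>

lemma section_tuplify:
  assumes f: "display W X f" and R: "relational_instance X I R"
    and k: "\<And>w. w \<in> Field W \<Longrightarrow> k w \<in> I (f w)"
    and n: "\<And>w w'. (w', w) \<in> W \<Longrightarrow> R (f w) (f w') (k w) = k w'"
  shows "section_along W X f (tuplify X e I R) (\<lambda>w. tup X e R (f w) (k w))"
  unfolding section_along_def
proof (intro conjI ballI allI impI)
  show "display W X f" by (rule f)
  show "is_inst X (tuplify X e I R)" by (rule tuplify_is_inst[OF R])
next
  fix w assume "w \<in> Field W"
  then show "tup X e R (f w) (k w) \<in> tuplify X e I R (f w)"
    using k display_Field[OF f] by (simp add: tuplify_def)
next
  fix w w' assume w: "(w', w) \<in> W"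
  then show "proj X (f w') (tup X e R (f w) (k w)) = tup X e R (f w') (k w')"
    using proj_tup[OF R display_rel[OF f w] k, of e] rel_Field[OF w] n by simp
qed


section \<open>Dependent sums\<close>

text \<open>
  Joint injectivity goes in two steps: the attributes of \<open>X\<close> determine the first component, and
  then the attributes of the schema of elements below \<open>(x, a)\<close> determine the second.
\<close>

lemma Sigma_relational:
  assumes J: "is_inst X J" and G: "is_inst (elts X J) G"
  shows "relational_instance X (Sigma_set J G) (Sigma_map X J)"
  unfolding relational_instance_def
proof (intro conjI ballI allI impI)
  note X = inst_schema[OF J]
  show "schema X" by (rule X)
  fix x assume x: "x \<in> Field X"
  have "Sigma_set J G x = Sigma (J x) (\<lambda>a. G (x, a))" by (auto simp: Sigma_set_def)
  then show "finite (Sigma_set J G x)"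
    using inst_finite[OF J x] inst_finite[OF G] x by (auto simp: elts_Field[OF J])
next
  fix x y assume yx: "(y, x) \<in> X"
  show "Sigma_map X J x y \<in> Sigma_set J G x \<rightarrow> Sigma_set J G y"
  proof
    fix k assume "k \<in> Sigma_set J G x"
    then obtain a b where k: "k = (a, b)" "a \<in> J x" "b \<in> G (x, a)" by (auto simp: Sigma_set_def)
    have "((y, proj X y a), (x, a)) \<in> elts X J"
      using yx k inst_proj[OF J yx] by (simp add: elts_def)
    from inst_proj[OF G this k(3)] show "Sigma_map X J x y k \<in> Sigma_set J G y"
      using inst_proj[OF J yx k(2)] by (simp add: Sigma_map_def Sigma_set_def k(1))
  qed
next
  fix x k assume x: "x \<in> Field X" and "k \<in> Sigma_set J G x"
  then obtain a b where k: "k = (a, b)" "a \<in> J x" "b \<in> G (x, a)" by (auto simp: Sigma_set_def)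
  have "(x, a) \<in> Field (elts X J)" using x k by (simp add: elts_Field[OF J])
  then show "Sigma_map X J x x k = k"
    using inst_ext[OF J x k(2)] inst_ext[OF G _ k(3)] by (simp add: Sigma_map_def k(1) proj_id)
next
  fix x y z k assume yz: "(y, x) \<in> X \<and> (z, y) \<in> X" and "k \<in> Sigma_set J G x"
  then obtain a b where k: "k = (a, b)" "a \<in> J x" "b \<in> G (x, a)" by (auto simp: Sigma_set_def)
  note X = inst_schema[OF J]
  have zx: "(z, x) \<in> X" using schema_trans[OF X] yz by blast
  have "((z, proj X z a), (y, proj X y a)) \<in> elts X J"
    using yz zx k inst_proj[OF J, of _ x a] by (simp add: elts_def proj_proj[OF X])
  then show "Sigma_map X J y z (Sigma_map X J x y k) = Sigma_map X J x z k"
    using yz by (simp add: Sigma_map_def k(1) proj_proj[OF X] proj_proj[OF elts_schema[OF J]])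
next
  fix x k l assume x: "x \<in> Field X" and "k \<in> Sigma_set J G x" "l \<in> Sigma_set J G x"
    and eq: "\<forall>A\<in>attrs_below X x. Sigma_map X J x A k = Sigma_map X J x A l"
  then obtain a b a' b' where k: "k = (a, b)" "a \<in> J x" "b \<in> G (x, a)"
    and l: "l = (a', b')" "a' \<in> J x" "b' \<in> G (x, a')"
    by (auto simp: Sigma_set_def)
  have "a = a'"
    by (rule tuple_eqI[OF inst_schema[OF J] inst_ext[OF J x k(2)] inst_ext[OF J x l(2)]])
      (use eq in \<open>simp add: Sigma_map_def k(1) l(1)\<close>)
  moreover have xa: "(x, a) \<in> Field (elts X J)" using x k by (simp add: elts_Field[OF J])
  have "b = b'"
    by (rule tuple_eqI[OF inst_schema[OF G] inst_ext[OF G xa k(3)]])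
      (use eq l \<open>a = a'\<close> inst_ext[OF G xa] in \<open>auto simp: Sigma_map_def k(1) l(1) elts_attrs[OF J x k(2)] elts_attrs[OF J x l(2)]\<close>)
  ultimately show "k = l" by (simp add: k l)
qed

lemma Sigma_entry_inj:
  assumes J: "is_inst X J" and G: "is_inst (elts X J) G" and A: "A \<in> basis X"
  shows "inj_on (Sigma_entry A) (Sigma_set J G A)"
proof (rule inj_onI)
  fix k l assume "k \<in> Sigma_set J G A" "l \<in> Sigma_set J G A" and eq: "Sigma_entry A k = Sigma_entry A l"
  then obtain a b a' b' where k: "k = (a, b)" "a \<in> J A" "b \<in> G (A, a)"
    and l: "l = (a', b')" "a' \<in> J A" "b' \<in> G (A, a')"
    by (auto simp: Sigma_set_def)
  have "a = a'"
    by (rule attr_tuple_eqI[OF J A k(2) l(2)]) (use eq in \<open>simp add: Sigma_entry_def k(1) l(1)\<close>)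
  moreover have "b = b'"
    by (rule attr_tuple_eqI[OF G, of "(A, a)"])
      (use A eq k l \<open>a = a'\<close> in \<open>simp_all add: Sigma_entry_def elts_basis[OF J]\<close>)
  ultimately show "k = l" by (simp add: k l)
qed

lemma Sigma_computation:
  fixes \<Gamma> A B C c0
  defines "S \<equiv> Sigma_inst \<Gamma> A B"
    and "W \<equiv> elts (elts \<Gamma> A) B"
  defines "dd \<equiv> comp_sub W (down \<Gamma> A) (down (elts \<Gamma> A) B)"
  defines "C' \<equiv> inst_sub W (hat W (pair_trm \<Gamma> A B)) (inst_sub (elts W (inst_sub W dd S)) (tilde W \<Gamma> dd S) C)"
  assumes A: "is_inst \<Gamma> A" and B: "is_inst (elts \<Gamma> A) B" and c: "is_trm W C' c0"
  shows "trm_sub W (hat W (pair_trm \<Gamma> A B))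
      (trm_sub (elts W (inst_sub W dd S)) (tilde W \<Gamma> dd S) (rec_Sigma \<Gamma> A B c0)) = c0"
proof -
  \<comment> \<open>the pair \<open>\<langle>a, b\<rangle>\<close> before tuplification\<close>
  define k where "k w = (snd (fst w), snd w)" for w :: "('a \<times> ('a \<Rightarrow> 'b)) \<times> ('a \<times> ('a \<Rightarrow> 'b) \<Rightarrow> 'c)"
  let ?g = "\<lambda>w. tup \<Gamma> Sigma_entry (Sigma_map \<Gamma> A) (dd w) (k w)"
  note R = Sigma_relational[OF A B]
  have dd: "display W \<Gamma> dd"
    unfolding W_def dd_def by (rule display_comp[OF display_down[OF B] display_down[OF A]])
  have WF: "fst w \<in> Field (elts \<Gamma> A)" if "w \<in> Field W" for w
    using that unfolding W_def by (auto simp: elts_Field[OF B])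
  have dda: "dd w = fst (fst w)" if "w \<in> Field W" for w
    using that WF[OF that] unfolding dd_def by (simp add: comp_sub_apply) (simp add: W_def down_apply)
  have km: "k w \<in> Sigma_set A B (dd w)" if "w \<in> Field W" for w
    using that unfolding dda[OF that] by (auto simp: W_def elts_Field[OF B] elts_Field[OF A] k_def Sigma_set_def)
  have s: "section_along W \<Gamma> dd S ?g"
    unfolding S_def Sigma_inst_def
  proof (rule section_tuplify[OF dd R km])
    fix w w' assume ww: "(w', w) \<in> W"
    then show "Sigma_map \<Gamma> A (dd w) (dd w') (k w) = k w'"
      using rel_Field[OF ww]
      by (auto simp: W_def Sigma_map_def k_def dda[unfolded W_def] dest!: elts_relD[of "fst w'" "snd w'" "fst w" "snd w", simplified]
          elts_relD[of "fst (fst w')" "snd (fst w')" "fst (fst w)" "snd (fst w)", simplified])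
  qed
  have h: "pair_pt \<Gamma> A w = (dd w, ?g w)" if "w \<in> Field W" for w
    using dda[OF that] by (simp add: pair_pt_def k_def split: prod.split)
  have t: "pair_trm \<Gamma> A B = (\<lambda>w\<in>Field W. reindex W dd w (?g w))"
  proof
    fix w
    have "reindex W (\<lambda>((y, _), _). y) w l = reindex W dd w l" for l
      by (rule reindex_cong) (auto simp: dda dest: attrs_Field)
    then show "pair_trm \<Gamma> A B w = (\<lambda>w\<in>Field W. reindex W dd w (?g w)) w"
      by (auto simp: pair_trm_def W_def[symmetric] dda k_def split: prod.splits)
  qed
  have r: "rec_Sigma \<Gamma> A B c0 (pair_pt \<Gamma> A w) = unreindex W (elts \<Gamma> S) (pair_pt \<Gamma> A) w (c0 w)"
    if w: "w \<in> Field W" for w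
  proof -
    have "untup \<Gamma> Sigma_entry (Sigma_set A B) (Sigma_map \<Gamma> A) (dd w) (?g w) = k w"
      by (rule untup_tup[OF R Sigma_entry_inj[OF A B] display_Field[OF dd w] km[OF w]])
    then show ?thesis
      using section_Field[OF s w] unfolding h[OF w]
      by (simp add: rec_Sigma_def S_def W_def k_def dda[OF w])
  qed
  show ?thesis
    by (rule eliminator_computation[OF s t h c[unfolded C'_def] r])
qed


section \<open>Identity types\<close>

text \<open>
  The maps restrict because equal tuples have equal restrictions.
\<close>

lemma Id_relational:
  assumes J: "is_inst X J"
  shows "relational_instance (Id_ctx X J) (Id_set X J) (\<lambda>_ _ u. u)"
  unfolding relational_instance_def
proof (intro conjI ballI allI impI)
  note d = display_down[OF J]
  note J' = inst_sub_is_inst[OF d J]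
  show "schema (Id_ctx X J)" unfolding Id_ctx_def by (rule elts_schema[OF J'])
  fix p q assume qp: "(q, p) \<in> Id_ctx X J"
  obtain x a b y a' b' where p: "p = ((x, a), b)" and q: "q = ((y, a'), b')" by (metis prod.exhaust)
  have 1: "((y, a'), (x, a)) \<in> elts X J" and 2: "proj (elts X J) (y, a') b = b'"
    using qp by (auto simp: Id_ctx_def elts_def p q)
  have 3: "proj X y a = a'" "a' \<in> J y" using elts_relD[OF 1] by auto
  have 4: "down X J (y, a') = y" using rel_Field[OF 1] by (simp add: down_apply)
  show "(\<lambda>u. u) \<in> Id_set X J p \<rightarrow> Id_set X J q"
    using proj_reindex[OF d 1, of a] by (auto simp: Id_set_def p q 2[symmetric] 3 4 split: if_splits)
qed simp_all

lemma Id_computation: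
  fixes \<Gamma> A C c0
  defines "E \<equiv> elts \<Gamma> A" and "D \<equiv> Id_inst \<Gamma> A"
  defines "EE \<equiv> elts E (inst_sub E (down \<Gamma> A) A)"
    and "vh \<equiv> hat E (var \<Gamma> A)"
  defines "ED \<equiv> elts E (inst_sub E vh D)"
  defines "C' \<equiv> inst_sub E (hat E (refl_trm \<Gamma> A)) (inst_sub ED (tilde E EE vh D) C)"
  assumes A: "is_inst \<Gamma> A" and c: "is_trm E C' c0"
  shows "trm_sub E (hat E (refl_trm \<Gamma> A)) (trm_sub ED (tilde E EE vh D) (rec_Id \<Gamma> A c0)) = c0"
proof -
  let ?g = "\<lambda>w. tup EE (\<lambda>_ u. u) (\<lambda>_ _ u. u) (vh w) ()"
  have EE: "Id_ctx \<Gamma> A = EE" by (simp add: Id_ctx_def EE_def E_def)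
  have vh: "display E EE vh"
    unfolding EE_def vh_def E_def by (rule display_hat[OF var_is_trm[OF A]])
  have vha: "vh w = (w, reindex E (down \<Gamma> A) w (snd w))" if "w \<in> Field E" for w
    using that unfolding vh_def E_def by (simp add: hat_apply var_apply)
  have s: "section_along E EE vh D ?g"
    unfolding D_def Id_inst_def EE
    by (rule section_tuplify[OF vh Id_relational[OF A, unfolded EE]])
      (auto simp: vha Id_set_def E_def split: prod.splits)
  have h: "refl_pt \<Gamma> A w = (vh w, ?g w)" if "w \<in> Field E" for w
    using that by (simp add: refl_pt_def Let_def vha EE E_def[symmetric] split: prod.splits)
  have t: "refl_trm \<Gamma> A = (\<lambda>w\<in>Field E. reindex E vh w (?g w))"
    by (simp add: refl_trm_def EE E_def[symmetric] vh_def[symmetric])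
  have r: "rec_Id \<Gamma> A c0 (refl_pt \<Gamma> A w) = unreindex E (elts EE D) (refl_pt \<Gamma> A) w (c0 w)"
    if w: "w \<in> Field E" for w
    using section_Field[OF s w] unfolding h[OF w]
    by (simp add: rec_Id_def EE D_def[symmetric] E_def[symmetric] vha[OF w] split: prod.splits)
  show ?thesis
    unfolding ED_def
    by (rule eliminator_computation[OF s t h c[unfolded C'_def ED_def] r])
qed


section \<open>Binary sums\<close>

text \<open>
  Joint injectivity needs an attribute below every element, since otherwise the two summands could
  not be told apart.
\<close>

lemma Plus_relational:
  assumes I: "is_inst X I" and J: "is_inst X J"
  shows "relational_instance X (Plus_set I J) (Plus_map X)"
  unfolding relational_instance_def
proof (intro conjI ballI allI impI)
  note X = inst_schema[OF I]
  show "schema X" by (rule X)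
  show "finite (Plus_set I J x)" if "x \<in> Field X" for x
    using inst_finite[OF I that] inst_finite[OF J that] by (simp add: Plus_set_def)
  show "Plus_map X x y \<in> Plus_set I J x \<rightarrow> Plus_set I J y" if "(y, x) \<in> X" for x y
    using inst_proj[OF I that] inst_proj[OF J that] by (auto simp: Plus_set_def Plus_map_def)
  show "Plus_map X x x k = k" if "x \<in> Field X" "k \<in> Plus_set I J x" for x k
    using that inst_ext[OF I that(1)] inst_ext[OF J that(1)]
    by (auto simp: Plus_set_def Plus_map_def proj_id)
  show "Plus_map X y z (Plus_map X x y k) = Plus_map X x z k"
    if "(y, x) \<in> X \<and> (z, y) \<in> X" "k \<in> Plus_set I J x" for x y z k
    using that by (auto simp: Plus_set_def Plus_map_def proj_proj[OF X])
  show "k = l" if x: "x \<in> Field X" and k: "k \<in> Plus_set I J x" and l: "l \<in> Plus_set I J x"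
    and eq: "\<forall>A\<in>attrs_below X x. Plus_map X x A k = Plus_map X x A l" for x k l
  proof -
    obtain A where "A \<in> attrs_below X x" using attrs_nonempty[OF X x] by auto
    then have "Plus_map X x A k = Plus_map X x A l" using eq by blast
    then consider (L) a a' where "k = Inl a" "l = Inl a'" "a \<in> I x" "a' \<in> I x"
      | (R) b b' where "k = Inr b" "l = Inr b'" "b \<in> J x" "b' \<in> J x"
      using k l by (auto simp: Plus_set_def Plus_map_def)
    then show ?thesis
    proof cases
      case L
      then show ?thesis
        using tuple_eqI[OF X inst_ext[OF I x L(3)] inst_ext[OF I x L(4)]] eq by (simp add: Plus_map_def)
    next
      case R
      then show ?thesis
        using tuple_eqI[OF X inst_ext[OF J x R(3)] inst_ext[OF J x R(4)]] eq by (simp add: Plus_map_def)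
    qed
  qed
qed

lemma Plus_entry_inj:
  assumes I: "is_inst X I" and J: "is_inst X J" and A: "A \<in> basis X"
  shows "inj_on (Plus_entry A) (Plus_set I J A)"
  using attr_tuple_eqI[OF I A] attr_tuple_eqI[OF J A]
  by (auto simp: inj_on_def Plus_entry_def Plus_set_def)

text \<open>
  Both computation rules at once: \<open>K\<close> is one of the summands and \<open>inc\<close> the injection of its
  elements into the sum.
\<close>

lemma Plus_computation:
  fixes X :: "'x rel" and K :: "'x \<Rightarrow> ('x \<Rightarrow> 'k) set"
    and inc :: "('x \<Rightarrow> 'k) \<Rightarrow> ('x \<Rightarrow> 'v) + ('x \<Rightarrow> 'w)"
    and I J C t
  defines "S \<equiv> Plus_inst X I J" and "E \<equiv> elts X K"
  defines "ES \<equiv> elts E (inst_sub E (down X K) S)"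
  defines "C' \<equiv> inst_sub E (hat E t) (inst_sub ES (tilde E X (down X K) S) C)"
  assumes I: "is_inst X I" and J: "is_inst X J" and K: "is_inst X K"
    and inc: "\<And>x k. k \<in> K x \<Longrightarrow> inc k \<in> Plus_set I J x"
    and inc_nat: "\<And>x y k. Plus_map X x y (inc k) = inc (proj X y k)"
    and t: "t = (\<lambda>(x, k)\<in>Field E.
      reindex E (down X K) (x, k) (tup X Plus_entry (Plus_map X) x (inc k)))"
    and h: "\<And>x k. h (x, k) = (x, tup X Plus_entry (Plus_map X) x (inc k))"
    and r: "\<And>x k l. (x, l) \<in> Field (elts X S) \<Longrightarrow>
      untup X Plus_entry (Plus_set I J) (Plus_map X) x l = inc k \<Longrightarrow>
      r (x, l) = unreindex E (elts X S) h (x, k) (c (x, k))"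
    and c: "is_trm E C' c"
  shows "trm_sub E (hat E t) (trm_sub ES (tilde E X (down X K) S) r) = c"
proof -
  let ?g = "\<lambda>w. tup X Plus_entry (Plus_map X) (down X K w) (inc (snd w))"
  note R = Plus_relational[OF I J]
  note d = display_down[OF K, folded E_def]
  have da: "down X K w = fst w" if "w \<in> Field E" for w using that by (simp add: E_def down_apply)
  have km: "inc (snd w) \<in> Plus_set I J (down X K w)" if "w \<in> Field E" for w
    using that inc by (auto simp: da E_def elts_Field[OF K] down_apply)
  have s: "section_along E X (down X K) S ?g"
    unfolding S_def Plus_inst_def
    by (rule section_tuplify[OF d R km])
      (use section_var[OF K] in \<open>auto simp: inc_nat E_def section_along_def\<close>)
  have h': "h w = (down X K w, ?g w)" if "w \<in> Field E" for w
    using that h[of "fst w" "snd w"] by (simp add: da)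
  have t': "t = (\<lambda>w\<in>Field E. reindex E (down X K) w (?g w))"
    unfolding t by (auto simp: E_def down_apply fun_eq_iff restrict_def)
  have r': "r (h w) = unreindex E (elts X S) h w (c w)" if w: "w \<in> Field E" for w
  proof -
    have "untup X Plus_entry (Plus_set I J) (Plus_map X) (down X K w) (?g w) = inc (snd w)"
      by (rule untup_tup[OF R Plus_entry_inj[OF I J] display_Field[OF d w] km[OF w]])
    from r[OF section_Field[OF s w] this] show ?thesis by (simp add: h'[OF w] da[OF w])
  qed
  show ?thesis
    unfolding ES_def
    by (rule eliminator_computation[OF s t' h' c[unfolded C'_def ES_def] r'])
qed

lemma Plus_computation_left:
  fixes X I J C c0 c1
  defines "S \<equiv> Plus_inst X I J" and "E \<equiv> elts X I"
  defines "ES \<equiv> elts E (inst_sub E (down X I) S)"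
  defines "C' \<equiv> inst_sub E (hat E (left_trm X I)) (inst_sub ES (tilde E X (down X I) S) C)"
  assumes I: "is_inst X I" and J: "is_inst X J" and c: "is_trm E C' c0"
  shows "trm_sub E (hat E (left_trm X I))
    (trm_sub ES (tilde E X (down X I) S) (rec_Plus X I J c0 c1)) = c0"
  unfolding S_def E_def ES_def
proof (rule Plus_computation[where inc = Inl and h = "left_pt X" and C = C])
  show "is_trm (elts X I)
      (inst_sub (elts X I) (hat (elts X I) (left_trm X I))
        (inst_sub
          (elts (elts X I) (inst_sub (elts X I) (down X I) (Plus_inst X I J)))
          (tilde (elts X I) X (down X I) (Plus_inst X I J)) C)) c0"
    using c unfolding C'_def ES_def E_def S_def .
qed (use I J in \<open>auto simp: Plus_set_def Plus_map_def left_trm_def left_pt_def rec_Plus_def\<close>)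

lemma Plus_computation_right:
  fixes X I J C c0 c1
  defines "S \<equiv> Plus_inst X I J" and "E \<equiv> elts X J"
  defines "ES \<equiv> elts E (inst_sub E (down X J) S)"
  defines "C' \<equiv> inst_sub E (hat E (right_trm X J)) (inst_sub ES (tilde E X (down X J) S) C)"
  assumes I: "is_inst X I" and J: "is_inst X J" and c: "is_trm E C' c1"
  shows "trm_sub E (hat E (right_trm X J))
    (trm_sub ES (tilde E X (down X J) S) (rec_Plus X I J c0 c1)) = c1"
  unfolding S_def E_def ES_def
proof (rule Plus_computation[where inc = Inr and h = "right_pt X" and C = C])
  show "is_trm (elts X J)
      (inst_sub (elts X J) (hat (elts X J) (right_trm X J))
        (inst_sub
          (elts (elts X J) (inst_sub (elts X J) (down X J) (Plus_inst X I J)))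
          (tilde (elts X J) X (down X J) (Plus_inst X I J)) C)) c1"
    using c unfolding C'_def ES_def E_def S_def .
qed (use I J in \<open>auto simp: Plus_set_def Plus_map_def right_trm_def right_pt_def rec_Plus_def\<close>)


section \<open>Dependent products\<close>

lemma Pi_index_mono: "schema X \<Longrightarrow> (y, x) \<in> X \<Longrightarrow> Pi_index X J y \<subseteq> Pi_index X J x"
  using schema_trans[of X] by (auto simp: Pi_index_def)

lemma Pi_index_Field: "is_inst X J \<Longrightarrow> Pi_index X J x \<subseteq> Field (elts X J)"
  by (auto simp: Pi_index_def elts_Field dest: rel_Field)

lemma Pi_index_down: "is_inst X J \<Longrightarrow> p \<in> Pi_index X J x \<Longrightarrow> (q, p) \<in> elts X J \<Longrightarrow> q \<in> Pi_index X J x"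
  using schema_trans[OF inst_schema, of X J] by (auto simp: Pi_index_def elts_def)

text \<open>
  The families in \<open>Xi_set\<close> are the matching families on the order ideal \<open>Pi_index\<close> of the schema of
  elements.
\<close>

lemma Xi_set_iff:
  "c \<in> Xi_set X J G x \<longleftrightarrow> c \<in> (\<Pi>\<^sub>E p\<in>Pi_index X J x. G p) \<and>
    (\<forall>p q. p \<in> Pi_index X J x \<and> (q, p) \<in> elts X J \<longrightarrow> proj (elts X J) q (c p) = c q)"
  unfolding Xi_set_def by (auto simp: Pi_index_def elts_def)

lemma Pi_relational:
  assumes J: "is_inst X J" and G: "is_inst (elts X J) G"
  shows "relational_instance X (Xi_set X J G) (Xi_map X J)"
  unfolding relational_instance_def
proof (intro conjI ballI allI impI)
  note X = inst_schema[OF J]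
  show "schema X" by (rule X)
  show "finite (Xi_set X J G x)" if x: "x \<in> Field X" for x
  proof (rule finite_subset)
    show "Xi_set X J G x \<subseteq> (\<Pi>\<^sub>E p\<in>Pi_index X J x. G p)" by (auto simp: Xi_set_iff)
    have "finite (Pi_index X J x)"
      by (rule finite_subset[OF Pi_index_Field[OF J] schema_finite[OF elts_schema[OF J]]])
    then show "finite (\<Pi>\<^sub>E p\<in>Pi_index X J x. G p)"
      using inst_finite[OF G] Pi_index_Field[OF J] by (intro finite_PiE) auto
  qed
  show "Xi_map X J x y \<in> Xi_set X J G x \<rightarrow> Xi_set X J G y" if yx: "(y, x) \<in> X" for x y
  proof
    fix c assume "c \<in> Xi_set X J G x"
    then have c: "\<And>p. p \<in> Pi_index X J x \<Longrightarrow> c p \<in> G p"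
      and n: "\<And>p q. p \<in> Pi_index X J x \<Longrightarrow> (q, p) \<in> elts X J \<Longrightarrow> proj (elts X J) q (c p) = c q"
      unfolding Xi_set_iff by blast+
    have sub: "p \<in> Pi_index X J x" if "p \<in> Pi_index X J y" for p
      using Pi_index_mono[OF X yx] that by blast
    show "Xi_map X J x y c \<in> Xi_set X J G y"
      unfolding Xi_set_iff Xi_map_def
      using c[OF sub] n[OF sub] Pi_index_down[OF J, of _ y] by (auto simp: PiE_iff)
  qed
  show "Xi_map X J x x k = k" if "x \<in> Field X" "k \<in> Xi_set X J G x" for x k
    using that by (auto simp: Xi_set_iff Xi_map_def PiE_def extensional_restrict)
  show "Xi_map X J y z (Xi_map X J x y k) = Xi_map X J x z k"
    if "(y, x) \<in> X \<and> (z, y) \<in> X" "k \<in> Xi_set X J G x" for x y z k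
    using Pi_index_mono[OF X, of z y] that
    by (auto simp: Xi_map_def restrict_def fun_eq_iff)
  show "c = d" if x: "x \<in> Field X" and c: "c \<in> Xi_set X J G x" and d: "d \<in> Xi_set X J G x"
    and eq: "\<forall>A\<in>attrs_below X x. Xi_map X J x A c = Xi_map X J x A d" for x c d
  proof (rule PiE_ext)
    show "c \<in> (\<Pi>\<^sub>E p\<in>Pi_index X J x. G p)" "d \<in> (\<Pi>\<^sub>E p\<in>Pi_index X J x. G p)"
      using c d by (auto simp: Xi_set_iff)
    fix p assume p: "p \<in> Pi_index X J x"
    then obtain y a where ya: "p = (y, a)" "(y, x) \<in> X" "a \<in> J y" by (auto simp: Pi_index_def)
    have pF: "p \<in> Field (elts X J)" using p Pi_index_Field[OF J] by auto
    have "c p \<in> G p" "d p \<in> G p" using c d p by (auto simp: Xi_set_iff simp del: split_paired_All dest: PiE_mem)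
    note ext = inst_ext[OF G pF this(1)] inst_ext[OF G pF this(2)]
    \<comment> \<open>the entries of \<open>c p\<close> are values of \<open>c\<close> at attributes of the schema of elements, and these
      are seen by the restriction of \<open>c\<close> to an attribute of \<open>X\<close>\<close>
    show "c p = d p"
    proof (rule tuple_eqI[OF elts_schema[OF J]])
      show "c p \<in> extensional (attrs_below (elts X J) p)" "d p \<in> extensional (attrs_below (elts X J) p)"
        by (fact ext)+
      fix q assume q: "q \<in> attrs_below (elts X J) p"
      note qp = attrs_rel[OF q]
      obtain A where A: "A \<in> attrs_below X y" "q = (A, proj X A a)"
        using q ya rel_Field[OF ya(2)] by (auto simp: elts_attrs[OF J])
      have Ax: "A \<in> attrs_below X x" using A attrs_mono[OF X ya(2)] by auto
      have "(A, A) \<in> X" using schema_refl[OF X] attrs_Field[OF A(1)] by blast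
      then have qi: "q \<in> Pi_index X J A"
        using elts_relD[of A "proj X A a" y a X J] qp by (simp add: A ya Pi_index_def)
      have "c q = d q"
        using fun_cong[OF bspec[OF eq Ax], of q] qi by (simp add: Xi_map_def)
      moreover have "proj (elts X J) q (c p) = c q" "proj (elts X J) q (d p) = d q"
        using c d p qp unfolding Xi_set_iff by blast+
      ultimately show "proj (elts X J) q (c p) = proj (elts X J) q (d p)" by simp
    qed
  qed
qed

lemma Pi_is_inst: "is_inst X J \<Longrightarrow> is_inst (elts X J) G \<Longrightarrow> is_inst X (Pi_inst X J G)"
  unfolding Pi_inst_def by (rule tuplify_is_inst[OF Pi_relational])

lemma attr_sing:
  assumes J: "is_inst X J" and A: "A \<in> basis X" and k: "k \<in> J A"
  shows "sing A (k A) = k"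
proof -
  have "k \<in> extensional {A}"
    using inst_ext[OF J _ k] basis_Field[OF inst_schema[OF J]] attrs_attr[OF inst_schema[OF J] A] A by auto
  then show ?thesis unfolding sing_def by (intro extensionalityI[of _ "{A}"]) auto
qed

text \<open>
  The identification of singleton tuples with their entries.
\<close>

lemma sing_mem_iff:
  assumes J: "is_inst X J" and A: "A \<in> basis X"
  shows "sing A v \<in> J A \<longleftrightarrow> v \<in> vals J A"
proof
  assume "sing A v \<in> J A"
  then have "(sing A v) A \<in> vals J A" unfolding vals_def by (rule imageI)
  then show "v \<in> vals J A" by (simp add: sing_def)
next
  assume "v \<in> vals J A"
  then show "sing A v \<in> J A" using attr_sing[OF J A] by (auto simp: vals_def)
qed

lemma Pi_index_attr:
  assumes J: "is_inst X J" and A: "A \<in> basis X"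
  shows "Pi_index X J A = Pair A ` J A"
  using below_attr[OF inst_schema[OF J] A] schema_refl[OF inst_schema[OF J]]
    basis_Field[OF inst_schema[OF J]] A
  by (auto simp: Pi_index_def)

text \<open>
  At an attribute \<open>A\<close> the index set consists of attributes of the schema of elements, so that a
  family is determined by the single entries of its members.
\<close>

lemma Pi_entry_inj:
  assumes J: "is_inst X J" and G: "is_inst (elts X J) G" and A: "A \<in> basis X"
  shows "inj_on (Pi_entry J A) (Xi_set X J G A)"
proof (rule inj_onI)
  fix c d assume c: "c \<in> Xi_set X J G A" and d: "d \<in> Xi_set X J G A"
    and eq: "Pi_entry J A c = Pi_entry J A d"
  show "c = d"
  proof (rule PiE_ext)
    show cd: "c \<in> (\<Pi>\<^sub>E p\<in>Pi_index X J A. G p)" "d \<in> (\<Pi>\<^sub>E p\<in>Pi_index X J A. G p)"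
      using c d by (auto simp: Xi_set_iff)
    fix p assume p: "p \<in> Pi_index X J A"
    then obtain k where k: "p = (A, k)" "k \<in> J A" by (auto simp: Pi_index_attr[OF J A])
    have "k A \<in> vals J A" using k by (simp add: vals_def)
    then have "c p p = d p p"
      using fun_cong[OF eq, of "k A"] by (simp add: Pi_entry_def attr_sing[OF J A k(2)] k(1))
    moreover have "p \<in> basis (elts X J)" using A k by (simp add: elts_basis[OF J])
    ultimately show "c p = d p"
      using attr_tuple_eqI[OF G] cd p by (metis PiE_mem)
  qed
qed

text \<open>
  Before tuplification the two operations are restriction of the full tuple to an order ideal and
  evaluation at the elements over \<open>x\<close>; tuplification cancels because \<open>Pi_entry\<close> is injective.
\<close>

lemma app_lam:
  assumes J: "is_inst X J" and G: "is_inst (elts X J) G" and b: "is_trm (elts X J) G b"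
  shows "app X J G (lam X J b) = b"
proof (rule extensionalityI[OF _ trm_extensional[OF b]])
  show "app X J G (lam X J b) \<in> extensional (Field (elts X J))"
    by (simp add: app_def)
  fix p assume p: "p \<in> Field (elts X J)"
  then obtain x a where xa: "p = (x, a)" "x \<in> Field X" "a \<in> J x" by (auto simp: elts_Field[OF J])
  let ?c = "\<lambda>p\<in>Pi_index X J x. b p"
  have "p \<in> Field (elts X J)" if "p \<in> Pi_index X J x" for p
    using Pi_index_Field[OF J] that by blast
  then have cX: "?c \<in> Xi_set X J G x"
    using Pi_index_down[OF J, of _ x]
    by (auto simp: Xi_set_iff PiE_iff trm_mem[OF b] trm_proj[OF b])
  have "untup X (Pi_entry J) (Xi_set X J G) (Xi_map X J) x
      (tup X (Pi_entry J) (Xi_map X J) x ?c) = ?c"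
    by (rule untup_tup[OF Pi_relational[OF J G] Pi_entry_inj[OF J G] xa(2) cX])
  moreover have "lam X J b x = tup X (Pi_entry J) (Xi_map X J) x ?c"
    using xa(2) by (simp add: lam_def)
  moreover have "p \<in> Pi_index X J x"
    using xa schema_refl[OF inst_schema[OF J]] by (simp add: Pi_index_def)
  ultimately show "app X J G (lam X J b) p = b p"
    using p by (simp add: app_def xa(1))
qed

text \<open>
  Dependent products are stable under substitution because a display morphism identifies the elements
  below \<open>x\<close> with those below \<open>f x\<close>; the matching families over the two ideals then correspond
  to each other. Since the products are on tuple form, this correspondence becomes an equality.
\<close>

lemma Pi_inst_sub:
  fixes X :: "'x rel" and Y :: "'y rel"
    and J :: "'y \<Rightarrow> ('y \<Rightarrow> 'v) set" and G :: "'y \<times> ('y \<Rightarrow> 'v) \<Rightarrow> ('y \<times> ('y \<Rightarrow> 'v) \<Rightarrow> 'w) set"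
  assumes f: "display X Y f" and J: "is_inst Y J" and G: "is_inst (elts Y J) G"
  shows "inst_sub X f (Pi_inst Y J G)
    = Pi_inst X (inst_sub X f J) (inst_sub (elts X (inst_sub X f J)) (tilde X Y f J) G)"
proof (rule extensionalityI[where A = "Field X"])
  note X = conjunct1[OF display_schema[OF f]] and Y = conjunct2[OF display_schema[OF f]]
  define J' where "J' = inst_sub X f J"
  define E where "E = elts Y J"
  define E' where "E' = elts X J'"
  define tl where "tl = tilde X Y f J"
  define G' where "G' = inst_sub E' tl G"
  have J': "is_inst X J'" unfolding J'_def by (rule inst_sub_is_inst[OF f J])
  have tl: "display E' E tl" unfolding E'_def E_def tl_def J'_def by (rule display_tilde[OF f J])
  have GE: "is_inst E G" using G by (simp add: E_def)
  have G': "is_inst E' G'" unfolding G'_def by (rule inst_sub_is_inst[OF tl GE])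
  have tla: "tl (y, a) = (f y, unreindex X Y f y a)" if "(y, a) \<in> Field E'" for y a
    using tilde_apply[of "(y, a)"] that by (simp add: tl_def E'_def J'_def)
  fix x assume x: "x \<in> Field X"
  define P where "P = Pi_index Y J (f x)"
  define P' where "P' = Pi_index X J' x"
  have P'F: "p \<in> Field E'" if "p \<in> P'" for p
    using Pi_index_Field[OF J'] that by (auto simp: P'_def E'_def)
  have tlP: "tl p \<in> P" if p: "p \<in> P'" for p
  proof -
    obtain y a where ya: "p = (y, a)" "(y, x) \<in> X" "a \<in> J' y" using p by (auto simp: P'_def Pi_index_def)
    show ?thesis
      using tla[of y a] P'F[OF p] display_rel[OF f ya(2)] unreindex_mem[OF f J _ ya(3)[unfolded J'_def]]
        rel_Field[OF ya(2)]
      by (simp add: ya(1) P_def Pi_index_def)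
  qed
  \<comment> \<open>the order ideals below \<open>x\<close> and \<open>f x\<close> are isomorphic along \<open>f\<close>, and so are the index sets
    of the families\<close>
  have bij: "bij_betw tl P' P"
  proof (rule bij_betw_imageI)
    show "inj_on tl P'"
    proof (rule inj_onI)
      fix p q assume pq: "p \<in> P'" "q \<in> P'" "tl p = tl q"
      obtain y a z b where y: "p = (y, a)" "(y, x) \<in> X" "a \<in> J' y"
        and z: "q = (z, b)" "(z, x) \<in> X" "b \<in> J' z"
        using pq by (auto simp: P'_def Pi_index_def)
      have eq: "f y = f z" "unreindex X Y f y a = unreindex X Y f z b"
        using pq(3) tla[of y a] tla[of z b] P'F pq(1,2) by (auto simp: y(1) z(1))
      have yz: "y = z" by (rule display_inj_below[OF f y(2) z(2) eq(1)])
      have yF: "y \<in> Field X" using rel_Field[OF y(2)] by simp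
      have zb: "b \<in> J' y" and eq': "unreindex X Y f y a = unreindex X Y f y b"
        using z(3) eq(2) yz by simp_all
      have "a = reindex X f y (unreindex X Y f y a)"
        by (rule reindex_unreindex[OF f yF inst_ext[OF J' yF y(3)], symmetric])
      also have "\<dots> = b"
        unfolding eq' by (rule reindex_unreindex[OF f yF inst_ext[OF J' yF zb]])
      finally have "a = b" .
      then show "p = q" using y z yz by simp
    qed
    show "tl ` P' = P"
    proof
      show "tl ` P' \<subseteq> P" using tlP by auto
      show "P \<subseteq> tl ` P'"
      proof
        fix r assume "r \<in> P"
        then obtain z k where r: "r = (z, k)" "(z, f x) \<in> Y" "k \<in> J z" by (auto simp: P_def Pi_index_def)
        obtain y where y: "(y, x) \<in> X" "f y = z" using display_below[OF f x r(2)] .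
        have yF: "y \<in> Field X" using rel_Field[OF y(1)] by simp
        have ya: "(y, reindex X f y k) \<in> P'"
          using y r yF by (auto simp: P'_def Pi_index_def J'_def inst_sub_apply)
        have "tl (y, reindex X f y k) = r"
          using tla[OF P'F[OF ya]] unreindex_reindex[OF f yF] inst_ext[OF J _ r(3)] rel_Field[OF r(2)]
          by (simp add: y(2) r(1))
        then show "r \<in> tl ` P'" using ya by force
      qed
    qed
  qed
  \<comment> \<open>transport of families along this bijection\<close>
  define \<phi> where "\<phi> c = (\<lambda>p\<in>P'. reindex E' tl p (c (tl p)))" for c :: "'y \<times> ('y \<Rightarrow> 'v) \<Rightarrow> 'y \<times> ('y \<Rightarrow> 'v) \<Rightarrow> 'w"
  have Xi: "c \<in> Xi_set Y J G (f x) \<longleftrightarrow> c \<in> (\<Pi>\<^sub>E p\<in>P. G p) \<and>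
      (\<forall>p q. p \<in> P \<and> (q, p) \<in> E \<longrightarrow> proj E q (c p) = c q)" for c
    by (simp add: Xi_set_iff P_def E_def)
  have Xi': "c \<in> Xi_set X J' G' x \<longleftrightarrow> c \<in> (\<Pi>\<^sub>E p\<in>P'. G' p) \<and>
      (\<forall>p q. p \<in> P' \<and> (q, p) \<in> E' \<longrightarrow> proj E' q (c p) = c q)" for c
    by (simp add: Xi_set_iff P'_def E'_def)
  have P'down: "q \<in> P'" if "p \<in> P'" "(q, p) \<in> E'" for p q
    using Pi_index_down[OF J'] that unfolding P'_def E'_def .
  have into: "\<phi> c \<in> Xi_set X J' G' x" if c: "c \<in> Xi_set Y J G (f x)" for c
    unfolding Xi'
  proof (intro conjI allI impI)
    show "\<phi> c \<in> (\<Pi>\<^sub>E p\<in>P'. G' p)"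
      using c tlP P'F by (auto simp: Xi \<phi>_def G'_def inst_sub_apply PiE_iff)
    fix p q assume pq: "p \<in> P' \<and> (q, p) \<in> E'"
    then have "proj E (tl q) (c (tl p)) = c (tl q)"
      using c tlP display_rel[OF tl] unfolding Xi by blast
    then show "proj E' q (\<phi> c p) = \<phi> c q"
      using pq P'down[of p q] proj_reindex[OF tl, of q p "c (tl p)"] by (simp add: \<phi>_def)
  qed
  have onto: "\<exists>c\<in>Xi_set Y J G (f x). \<phi> c = c'" if c': "c' \<in> Xi_set X J' G' x" for c'
  proof -
    define iv where "iv = inv_into P' tl"
    have iv1: "iv (tl p) = p" if "p \<in> P'" for p
      using bij that by (simp add: iv_def bij_betw_def)
    have iv2: "iv r \<in> P'" "tl (iv r) = r" if "r \<in> P" for r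
      using bij that by (auto simp: iv_def bij_betw_def inv_into_into f_inv_into_f)
    define c where "c = (\<lambda>r\<in>P. unreindex E' E tl (iv r) (c' (iv r)))"
    have c'm: "c' p \<in> inst_sub E' tl G p" if "p \<in> P'" for p
      using c' that unfolding Xi' G'_def[symmetric] by auto
    have c'e: "c' p \<in> extensional (attrs_below E' p)" if "p \<in> P'" for p
      using inst_ext[OF G' P'F[OF that]] c'm[OF that] by (simp add: G'_def)
    have "c \<in> Xi_set Y J G (f x)"
      unfolding Xi
    proof (intro conjI allI impI)
      show "c \<in> (\<Pi>\<^sub>E p\<in>P. G p)"
      proof (rule PiE_I)
        fix r assume r: "r \<in> P"
        show "c r \<in> G r"
          using unreindex_mem[OF tl GE P'F[OF iv2(1)[OF r]] c'm[OF iv2(1)[OF r]]] r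
          by (simp add: c_def iv2(2)[OF r])
      qed (simp add: c_def)
      fix r s assume rs: "r \<in> P \<and> (s, r) \<in> E"
      then have r: "r \<in> P" and sr: "(s, r) \<in> E" by auto
      obtain q where q: "(q, iv r) \<in> E'" "tl q = s"
        using display_below[OF tl P'F[OF iv2(1)[OF r]], of s] sr iv2(2)[OF r] by auto
      have qP: "q \<in> P'" by (rule P'down[OF iv2(1)[OF r] q(1)])
      have sP: "s \<in> P" using tlP[OF qP] q(2) by simp
      have "proj E s (c r) = unreindex E' E tl q (proj E' q (c' (iv r)))"
        using proj_unreindex[OF tl q(1) c'e[OF iv2(1)[OF r]]] r by (simp add: q(2) c_def)
      also have "proj E' q (c' (iv r)) = c' q" using c' q(1) iv2(1)[OF r] unfolding Xi' by blast
      also have "unreindex E' E tl q (c' q) = c s" using sP iv1[OF qP] q(2) by (auto simp: c_def)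
      finally show "proj E s (c r) = c s" .
    qed
    moreover have "\<phi> c = c'"
    proof (rule extensionalityI[where A = P'])
      show "c' \<in> extensional P'" using c' by (auto simp: Xi' PiE_def)
      fix p assume p: "p \<in> P'"
      then show "\<phi> c p = c' p"
        using reindex_unreindex[OF tl P'F[OF p] c'e[OF p]] by (simp add: \<phi>_def c_def tlP iv1)
    qed (simp add: \<phi>_def)
    ultimately show ?thesis by blast
  qed
  \<comment> \<open>after tuplification the transport is plain reindexing: at an attribute \<open>D\<close> both tuples have
    the entry \<open>v \<mapsto> c (f D, sing (f D) v) (f D, sing (f D) v)\<close>\<close>
  have entries: "reindex X f x (tup Y (Pi_entry J) (Xi_map Y J) (f x) c)
      = tup X (Pi_entry J') (Xi_map X J') x (\<phi> c)" for c
  proof (rule extensionalityI[where A = "attrs_below X x"])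
    fix D assume D: "D \<in> attrs_below X x"
    note fD = display_attr[OF f D]
    note Db = attr_in_basis[OF D] and fDb = attr_in_basis[OF fD]
    have DF: "D \<in> Field X" using attrs_Field[OF D] by simp
    have DD: "attrs_below X D = {D}" by (rule attrs_attr[OF X Db])
    have J'D: "J' D = reindex X f D ` J (f D)" using DF by (simp add: J'_def inst_sub_apply)
    have vals: "vals J' D = vals J (f D)"
      by (simp add: vals_def J'D image_image reindex_apply DD)
    have "Pi_entry J (f D) (Xi_map Y J (f x) (f D) c) v = Pi_entry J' D (Xi_map X J' x D (\<phi> c)) v" for v
    proof (cases "v \<in> vals J (f D)")
      case True
      let ?p = "(D, sing D v)" and ?r = "(f D, sing (f D) v)"
      have r: "sing (f D) v \<in> J (f D)" using True sing_mem_iff[OF J fDb] by simp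
      have p: "sing D v \<in> J' D" using True sing_mem_iff[OF J' Db] by (simp add: vals)
      have pi: "?p \<in> Pi_index X J' D" "?r \<in> Pi_index Y J (f D)"
        using p r by (simp_all add: Pi_index_attr[OF J' Db] Pi_index_attr[OF J fDb])
      have pP: "?p \<in> P'" using Pi_index_mono[OF X attrs_rel[OF D]] pi(1) by (auto simp: P'_def)
      have re: "reindex X f D (sing (f D) v) = sing D v"
        by (simp add: reindex_def DD sing_def restrict_def fun_eq_iff)
      have "unreindex X Y f D (sing D v) = sing (f D) v"
        using unreindex_reindex[OF f DF inst_ext[OF J _ r]] attrs_Field[OF fD] by (simp add: re)
      then have tp: "tl ?p = ?r" using tla[OF P'F[OF pP]] by simp
      have "?p \<in> basis E'" using Db p by (simp add: E'_def elts_basis[OF J'])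
      then have "attrs_below E' ?p = {?p}"
        unfolding E'_def by (rule attrs_attr[OF elts_schema[OF J']])
      then have "\<phi> c ?p ?p = c ?r ?r" using pP by (simp add: \<phi>_def reindex_apply tp)
      then show ?thesis using True pi by (simp add: Pi_entry_def vals Xi_map_def)
    next
      case False
      then show ?thesis by (simp add: Pi_entry_def vals)
    qed
    then show "reindex X f x (tup Y (Pi_entry J) (Xi_map Y J) (f x) c) D
      = tup X (Pi_entry J') (Xi_map X J') x (\<phi> c) D"
      using D fD by (simp add: reindex_apply tup_def fun_eq_iff)
  qed (simp_all add: tup_def)
  have img: "\<phi> ` Xi_set Y J G (f x) = Xi_set X J' G' x" using into onto by (auto simp: image_iff)
  have "inst_sub X f (Pi_inst Y J G) x
      = (\<lambda>c. tup X (Pi_entry J') (Xi_map X J') x (\<phi> c)) ` Xi_set Y J G (f x)"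
    using x display_Field[OF f x]
    by (simp add: inst_sub_apply Pi_inst_def tuplify_def image_image entries)
  also have "\<dots> = Pi_inst X J' G' x"
    using x by (simp add: Pi_inst_def tuplify_def img[symmetric] image_image)
  finally show "inst_sub X f (Pi_inst Y J G) x
    = Pi_inst X (inst_sub X f J) (inst_sub (elts X (inst_sub X f J)) (tilde X Y f J) G) x"
    by (simp add: J'_def G'_def E'_def tl_def)
qed (simp_all add: inst_sub_def Pi_inst_def tuplify_def)


section \<open>Standard simplices and face maps\<close>

lemma
  shows simplex_schema: "schema (simplex n)"
    and simplex_Field: "Field (simplex n) = {S. S \<noteq> {} \<and> S \<subseteq> {0..n}}"
    and simplex_attrs: "\<And>S. S \<noteq> {} \<Longrightarrow> S \<subseteq> {0..n} \<Longrightarrow> attrs_below (simplex n) S = (\<lambda>k. {k}) ` S"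
proof -
  let ?F = "{S. S \<noteq> {} \<and> S \<subseteq> {0..n}}"
  have "schema (simplex n) \<and> Field (simplex n) = ?F \<and> basis (simplex n) = (\<lambda>k. {k}) ` {0..n} \<and>
      (\<forall>S\<in>?F. attrs_below (simplex n) S = (\<lambda>k. {k}) ` S)"
  proof (rule schema_of_attributes)
    show "finite ?F" by (rule finite_subset[of _ "Pow {0..n}"]) auto
    fix S Y assume S: "S \<in> ?F" "Y \<noteq> {}" "Y \<subseteq> (\<lambda>k. {k}) ` S"
    then obtain T where "T \<subseteq> S" "Y = (\<lambda>k. {k}) ` T" by (auto simp: subset_image_iff)
    then have "T \<in> ?F" using S by auto
    with \<open>Y = (\<lambda>k. {k}) ` T\<close> show "\<exists>T\<in>?F. (\<lambda>k. {k}) ` T = Y" by blast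
  qed (auto simp: simplex_def inj_image_eq_iff)
  then show "schema (simplex n)" "Field (simplex n) = {S. S \<noteq> {} \<and> S \<subseteq> {0..n}}"
    "\<And>S. S \<noteq> {} \<Longrightarrow> S \<subseteq> {0..n} \<Longrightarrow> attrs_below (simplex n) S = (\<lambda>k. {k}) ` S"
    by simp_all
qed

lemma display_face: "display (simplex n) (simplex (Suc n)) (face n i)"
proof -
  let ?d = "\<lambda>k. if k < i then k else k + 1"
  have F: "?d ` S \<noteq> {} \<and> ?d ` S \<subseteq> {0..Suc n}" if "S \<noteq> {}" "S \<subseteq> {0..n}" for S
    using that by auto
  have fa: "face n i S = ?d ` S" if "S \<noteq> {}" "S \<subseteq> {0..n}" for S
    using that by (simp add: face_def simplex_Field)
  have "bij_betw (face n i) (attrs_below (simplex n) S) (attrs_below (simplex (Suc n)) (face n i S))"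
    if S: "S \<noteq> {}" "S \<subseteq> {0..n}" for S
  proof -
    have v: "face n i {k} = {?d k}" if "k \<in> S" for k using fa[of "{k}"] S that by auto
    have "face n i ` (\<lambda>k. {k}) ` S = (\<lambda>k. {k}) ` ?d ` S"
      unfolding image_image by (rule image_cong[OF refl v])
    moreover have "inj_on (face n i) ((\<lambda>k. {k}) ` S)"
      by (rule inj_onI) (auto simp: v split: if_splits)
    moreover have "attrs_below (simplex (Suc n)) (?d ` S) = (\<lambda>k. {k}) ` ?d ` S"
      by (rule simplex_attrs) (use F[OF S] in blast)+
    ultimately show ?thesis
      unfolding simplex_attrs[OF S] fa[OF S] by (simp only: bij_betw_def)
  qed
  moreover have "face n i \<in> Field (simplex n) \<rightarrow>\<^sub>E Field (simplex (Suc n))"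
  proof (rule PiE_I)
    show "face n i S \<in> Field (simplex (Suc n))" if "S \<in> Field (simplex n)" for S
      using that F[of S] fa[of S] by (auto simp: simplex_Field)
  qed (simp add: face_def)
  ultimately show ?thesis by (simp add: display_iff simplex_schema simplex_Field)
qed

text \<open>
  The simplicial identity already holds for the maps on vertices.
\<close>

lemma face_face:
  assumes "i < j"
  shows "comp_sub (simplex n) (face (Suc n) j) (face n i)
    = comp_sub (simplex n) (face (Suc n) i) (face n (j - 1))"
proof (rule extensionalityI[where A = "Field (simplex n)"])
  fix S assume S: "S \<in> Field (simplex n)"
  have *: "face n l S \<in> Field (simplex (Suc n))" for l by (rule display_Field[OF display_face S])
  show "comp_sub (simplex n) (face (Suc n) j) (face n i) S
    = comp_sub (simplex n) (face (Suc n) i) (face n (j - 1)) S"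
    using S *[of i] *[of "j - 1"] assms
    by (simp add: comp_sub_apply) (auto simp: face_def image_image intro!: image_cong)
qed (simp_all add: comp_sub_def compose_def)


section \<open>Soundness\<close>

lemma eq_trmI: "is_trm X A u \<Longrightarrow> t = u \<Longrightarrow> eq_trm X A t u"
  by (simp add: eq_trm_def)

theorem theorem1:
  shows
    \<comment> \<open>(E1)\<close>
    "(\<forall>(\<Xi> :: 'a rel) (\<Theta> :: 'b rel) (\<Delta> :: 'c rel) (\<Gamma> :: 'd rel) \<sigma> \<tau> \<upsilon>.
        display \<Xi> \<Theta> \<sigma> \<and> display \<Theta> \<Delta> \<tau> \<and> display \<Delta> \<Gamma> \<upsilon> \<longrightarrow>
        eq_sub \<Xi> \<Gamma> (comp_sub \<Xi> (comp_sub \<Theta> \<upsilon> \<tau>) \<sigma>) (comp_sub \<Xi> \<upsilon> (comp_sub \<Xi> \<tau> \<sigma>)))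
   \<and> \<comment> \<open>(E2)\<close>
     (\<forall>(\<Delta> :: 'a rel) (\<Gamma> :: 'b rel) \<sigma>.
        display \<Delta> \<Gamma> \<sigma> \<longrightarrow> eq_sub \<Delta> \<Gamma> (comp_sub \<Delta> (id_sub \<Gamma>) \<sigma>) \<sigma>)
   \<and> \<comment> \<open>(E3)\<close>
     (\<forall>(\<Delta> :: 'a rel) (\<Gamma> :: 'b rel) \<sigma>.
        display \<Delta> \<Gamma> \<sigma> \<longrightarrow> eq_sub \<Delta> \<Gamma> (comp_sub \<Delta> \<sigma> (id_sub \<Delta>)) \<sigma>)
   \<and> \<comment> \<open>(E4)\<close>
     (\<forall>(\<Theta> :: 'a rel) (\<Delta> :: 'b rel) (\<Gamma> :: 'c rel) \<sigma> \<tau> (A :: 'c \<Rightarrow> ('c \<Rightarrow> 'v) set).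
        display \<Delta> \<Gamma> \<sigma> \<and> display \<Theta> \<Delta> \<tau> \<and> is_inst \<Gamma> A \<longrightarrow>
        eq_type \<Theta> (inst_sub \<Theta> (comp_sub \<Theta> \<sigma> \<tau>) A) (inst_sub \<Theta> \<tau> (inst_sub \<Delta> \<sigma> A)))
   \<and> \<comment> \<open>(E5)\<close>
     (\<forall>(\<Gamma> :: 'a rel) (A :: 'a \<Rightarrow> ('a \<Rightarrow> 'v) set).
        is_inst \<Gamma> A \<longrightarrow> eq_type \<Gamma> (inst_sub \<Gamma> (id_sub \<Gamma>) A) A)
   \<and> \<comment> \<open>(E6)\<close>
     (\<forall>(\<Theta> :: 'a rel) (\<Delta> :: 'b rel) (\<Gamma> :: 'c rel) \<sigma> \<tau> (A :: 'c \<Rightarrow> ('c \<Rightarrow> 'v) set) a.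
        display \<Delta> \<Gamma> \<sigma> \<and> display \<Theta> \<Delta> \<tau> \<and> is_inst \<Gamma> A \<and> is_trm \<Gamma> A a \<longrightarrow>
        eq_trm \<Theta> (inst_sub \<Theta> \<tau> (inst_sub \<Delta> \<sigma> A))
          (trm_sub \<Theta> (comp_sub \<Theta> \<sigma> \<tau>) a) (trm_sub \<Theta> \<tau> (trm_sub \<Delta> \<sigma> a)))
   \<and> \<comment> \<open>(E7)\<close>
     (\<forall>(\<Gamma> :: 'a rel) (A :: 'a \<Rightarrow> ('a \<Rightarrow> 'v) set) a.
        is_inst \<Gamma> A \<and> is_trm \<Gamma> A a \<longrightarrow> eq_trm \<Gamma> A (trm_sub \<Gamma> (id_sub \<Gamma>) a) a)
   \<and> \<comment> \<open>(E8)\<close>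
     (\<forall>(\<Gamma> :: 'a rel) (A :: 'a \<Rightarrow> ('a \<Rightarrow> 'v) set) a.
        is_inst \<Gamma> A \<and> is_trm \<Gamma> A a \<longrightarrow>
        eq_sub \<Gamma> \<Gamma> (comp_sub \<Gamma> (down \<Gamma> A) (hat \<Gamma> a)) (id_sub \<Gamma>))
   \<and> \<comment> \<open>(E9)\<close>
     (\<forall>(\<Gamma> :: 'a rel) (A :: 'a \<Rightarrow> ('a \<Rightarrow> 'v) set) a.
        is_inst \<Gamma> A \<and> is_trm \<Gamma> A a \<longrightarrow>
        eq_trm \<Gamma> A (trm_sub \<Gamma> (hat \<Gamma> a) (var \<Gamma> A)) a)
   \<and> \<comment> \<open>(E10)\<close>
     (\<forall>(\<Delta> :: 'a rel) (\<Gamma> :: 'b rel) \<sigma> (A :: 'b \<Rightarrow> ('b \<Rightarrow> 'v) set).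
        display \<Delta> \<Gamma> \<sigma> \<and> is_inst \<Gamma> A \<longrightarrow>
        eq_sub (elts \<Delta> (inst_sub \<Delta> \<sigma> A)) \<Gamma>
          (comp_sub (elts \<Delta> (inst_sub \<Delta> \<sigma> A)) (down \<Gamma> A) (tilde \<Delta> \<Gamma> \<sigma> A))
          (comp_sub (elts \<Delta> (inst_sub \<Delta> \<sigma> A)) \<sigma> (down \<Delta> (inst_sub \<Delta> \<sigma> A))))
   \<and> \<comment> \<open>(E11)\<close>
     (\<forall>(\<Delta> :: 'a rel) (\<Gamma> :: 'b rel) \<sigma> (A :: 'b \<Rightarrow> ('b \<Rightarrow> 'v) set).
        display \<Delta> \<Gamma> \<sigma> \<and> is_inst \<Gamma> A \<longrightarrow>
        eq_trm (elts \<Delta> (inst_sub \<Delta> \<sigma> A))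
          (inst_sub (elts \<Delta> (inst_sub \<Delta> \<sigma> A)) (down \<Delta> (inst_sub \<Delta> \<sigma> A)) (inst_sub \<Delta> \<sigma> A))
          (trm_sub (elts \<Delta> (inst_sub \<Delta> \<sigma> A)) (tilde \<Delta> \<Gamma> \<sigma> A) (var \<Gamma> A))
          (var \<Delta> (inst_sub \<Delta> \<sigma> A)))
   \<and> \<comment> \<open>(E12)\<close>
     (\<forall>(\<Delta> :: 'a rel) (\<Gamma> :: 'b rel) \<sigma> (A :: 'b \<Rightarrow> ('b \<Rightarrow> 'v) set) a.
        display \<Delta> \<Gamma> \<sigma> \<and> is_inst \<Gamma> A \<and> is_trm \<Gamma> A a \<longrightarrow>
        eq_sub \<Delta> (elts \<Gamma> A)
          (comp_sub \<Delta> (tilde \<Delta> \<Gamma> \<sigma> A) (hat \<Delta> (trm_sub \<Delta> \<sigma> a)))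
          (comp_sub \<Delta> (hat \<Gamma> a) \<sigma>))
   \<and> \<comment> \<open>(E13)\<close>
     (\<forall>(\<Theta> :: 'a rel) (\<Delta> :: 'b rel) (\<Gamma> :: 'c rel) \<sigma> \<tau> (A :: 'c \<Rightarrow> ('c \<Rightarrow> 'v) set).
        display \<Delta> \<Gamma> \<sigma> \<and> display \<Theta> \<Delta> \<tau> \<and> is_inst \<Gamma> A \<longrightarrow>
        eq_sub (elts \<Theta> (inst_sub \<Theta> (comp_sub \<Theta> \<sigma> \<tau>) A)) (elts \<Gamma> A)
          (comp_sub (elts \<Theta> (inst_sub \<Theta> \<tau> (inst_sub \<Delta> \<sigma> A)))
            (tilde \<Delta> \<Gamma> \<sigma> A) (tilde \<Theta> \<Delta> \<tau> (inst_sub \<Delta> \<sigma> A)))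
          (tilde \<Theta> \<Gamma> (comp_sub \<Theta> \<sigma> \<tau>) A))
   \<and> \<comment> \<open>(E14)\<close>
     (\<forall>(\<Gamma> :: 'a rel) (A :: 'a \<Rightarrow> ('a \<Rightarrow> 'v) set).
        is_inst \<Gamma> A \<longrightarrow>
        eq_sub (elts \<Gamma> A) (elts \<Gamma> A)
          (comp_sub (elts \<Gamma> A) (tilde (elts \<Gamma> A) \<Gamma> (down \<Gamma> A) A) (hat (elts \<Gamma> A) (var \<Gamma> A)))
          (id_sub (elts \<Gamma> A)))
   \<and> \<comment> \<open>(E15)\<close>
     (\<forall>(\<Delta> :: 'a rel) (\<Gamma> :: 'b rel) \<sigma> (A :: 'b \<Rightarrow> ('b \<Rightarrow> 'v) set)
        (B :: 'b \<times> ('b \<Rightarrow> 'v) \<Rightarrow> ('b \<times> ('b \<Rightarrow> 'v) \<Rightarrow> 'w) set).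
        display \<Delta> \<Gamma> \<sigma> \<and> is_inst \<Gamma> A \<and> is_inst (elts \<Gamma> A) B \<longrightarrow>
        eq_type \<Delta> (inst_sub \<Delta> \<sigma> (Pi_inst \<Gamma> A B))
          (Pi_inst \<Delta> (inst_sub \<Delta> \<sigma> A)
            (inst_sub (elts \<Delta> (inst_sub \<Delta> \<sigma> A)) (tilde \<Delta> \<Gamma> \<sigma> A) B)))
   \<and> \<comment> \<open>(E16)\<close>
     (\<forall>(\<Gamma> :: 'a rel) (A :: 'a \<Rightarrow> ('a \<Rightarrow> 'v) set)
        (B :: 'a \<times> ('a \<Rightarrow> 'v) \<Rightarrow> ('a \<times> ('a \<Rightarrow> 'v) \<Rightarrow> 'w) set) b.
        is_inst \<Gamma> A \<and> is_inst (elts \<Gamma> A) B \<and> is_trm (elts \<Gamma> A) B b \<longrightarrow>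
        eq_trm (elts \<Gamma> A) B (app \<Gamma> A B (lam \<Gamma> A b)) b)
   \<and> \<comment> \<open>(E17)\<close>
     (\<forall>(\<Gamma> :: 'a rel) (A :: 'a \<Rightarrow> ('a \<Rightarrow> 'v) set)
        (B :: 'a \<times> ('a \<Rightarrow> 'v) \<Rightarrow> ('a \<times> ('a \<Rightarrow> 'v) \<Rightarrow> 'w) set)
        (C :: 'a \<times> ('a \<Rightarrow> 'v \<times> 'w) \<Rightarrow> ('a \<times> ('a \<Rightarrow> 'v \<times> 'w) \<Rightarrow> 'u) set) c0.
        let S = Sigma_inst \<Gamma> A B;
            \<Gamma>AB = elts (elts \<Gamma> A) B;
            dd = comp_sub \<Gamma>AB (down \<Gamma> A) (down (elts \<Gamma> A) B);
            ddS = tilde \<Gamma>AB \<Gamma> dd S;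
            \<Gamma>ABS = elts \<Gamma>AB (inst_sub \<Gamma>AB dd S);
            pr = hat \<Gamma>AB (pair_trm \<Gamma> A B);
            C' = inst_sub \<Gamma>AB pr (inst_sub \<Gamma>ABS ddS C)
        in is_inst \<Gamma> A \<and> is_inst (elts \<Gamma> A) B \<and> is_inst (elts \<Gamma> S) C \<and> is_trm \<Gamma>AB C' c0 \<longrightarrow>
           eq_trm \<Gamma>AB C' (trm_sub \<Gamma>AB pr (trm_sub \<Gamma>ABS ddS (rec_Sigma \<Gamma> A B c0))) c0)
   \<and> \<comment> \<open>(E18)\<close>
     (\<forall>(\<Gamma> :: 'a rel) (A :: 'a \<Rightarrow> ('a \<Rightarrow> 'v) set)
        (C :: (('a \<times> ('a \<Rightarrow> 'v)) \<times> ('a \<times> ('a \<Rightarrow> 'v) \<Rightarrow> 'v))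
               \<times> (('a \<times> ('a \<Rightarrow> 'v)) \<times> ('a \<times> ('a \<Rightarrow> 'v) \<Rightarrow> 'v) \<Rightarrow> unit)
             \<Rightarrow> ((('a \<times> ('a \<Rightarrow> 'v)) \<times> ('a \<times> ('a \<Rightarrow> 'v) \<Rightarrow> 'v))
               \<times> (('a \<times> ('a \<Rightarrow> 'v)) \<times> ('a \<times> ('a \<Rightarrow> 'v) \<Rightarrow> 'v) \<Rightarrow> unit) \<Rightarrow> 'u) set) c0.
        let \<Gamma>A = elts \<Gamma> A;
            \<Gamma>AA = elts \<Gamma>A (inst_sub \<Gamma>A (down \<Gamma> A) A);
            D = Id_inst \<Gamma> A;
            vh = hat \<Gamma>A (var \<Gamma> A);
            vD = tilde \<Gamma>A \<Gamma>AA vh D;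
            \<Gamma>AD = elts \<Gamma>A (inst_sub \<Gamma>A vh D);
            rf = hat \<Gamma>A (refl_trm \<Gamma> A);
            C' = inst_sub \<Gamma>A rf (inst_sub \<Gamma>AD vD C)
        in is_inst \<Gamma> A \<and> is_inst (elts \<Gamma>AA D) C \<and> is_trm \<Gamma>A C' c0 \<longrightarrow>
           eq_trm \<Gamma>A C' (trm_sub \<Gamma>A rf (trm_sub \<Gamma>AD vD (rec_Id \<Gamma> A c0))) c0)
   \<and> \<comment> \<open>(E19)\<close>
     (\<forall>(\<Gamma> :: 'a rel) (A :: 'a \<Rightarrow> ('a \<Rightarrow> 'v) set) (B :: 'a \<Rightarrow> ('a \<Rightarrow> 'w) set)
        (C :: 'a \<times> ('a \<Rightarrow> 'v + 'w) \<Rightarrow> ('a \<times> ('a \<Rightarrow> 'v + 'w) \<Rightarrow> 'u) set) c0 c1.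
        let S = Plus_inst \<Gamma> A B;
            \<Gamma>A = elts \<Gamma> A;
            \<Gamma>B = elts \<Gamma> B;
            dA = tilde \<Gamma>A \<Gamma> (down \<Gamma> A) S;
            dB = tilde \<Gamma>B \<Gamma> (down \<Gamma> B) S;
            \<Gamma>AS = elts \<Gamma>A (inst_sub \<Gamma>A (down \<Gamma> A) S);
            \<Gamma>BS = elts \<Gamma>B (inst_sub \<Gamma>B (down \<Gamma> B) S);
            lf = hat \<Gamma>A (left_trm \<Gamma> A);
            rt = hat \<Gamma>B (right_trm \<Gamma> B);
            CA = inst_sub \<Gamma>A lf (inst_sub \<Gamma>AS dA C);
            CB = inst_sub \<Gamma>B rt (inst_sub \<Gamma>BS dB C);
            r = rec_Plus \<Gamma> A B c0 c1
        in is_inst \<Gamma> A \<and> is_inst \<Gamma> B \<and> is_inst (elts \<Gamma> S) C \<and>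
           is_trm \<Gamma>A CA c0 \<and> is_trm \<Gamma>B CB c1 \<longrightarrow>
           eq_trm \<Gamma>A CA (trm_sub \<Gamma>A lf (trm_sub \<Gamma>AS dA r)) c0 \<and>
           eq_trm \<Gamma>B CB (trm_sub \<Gamma>B rt (trm_sub \<Gamma>BS dB r)) c1)
   \<and> \<comment> \<open>(E20)\<close>
     (\<forall>n i j. i < j \<and> j \<le> n + 2 \<longrightarrow>
        eq_sub (simplex n) (simplex (n + 2))
          (comp_sub (simplex n) (face (n + 1) j) (face n i))
          (comp_sub (simplex n) (face (n + 1) i) (face n (j - 1))))"
  unfolding Let_def
proof (intro conjI allI impI, goal_cases)
  case (1 \<Xi> \<Theta> \<Delta> \<Gamma> \<sigma> \<tau> \<upsilon>)
  then show ?case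
    using display_comp[of \<Xi> \<Theta> \<sigma> \<Gamma> "comp_sub \<Theta> \<upsilon> \<tau>"] display_comp[of \<Theta> \<Delta> \<tau> \<Gamma> \<upsilon>]
      comp_sub_assoc[of \<Xi> \<Theta> \<sigma> \<upsilon> \<tau>]
    by (simp add: eq_sub_def)
next
  case (2 \<Delta> \<Gamma> \<sigma>)
  then show ?case by (simp add: eq_sub_def comp_sub_id_left)
next
  case (3 \<Delta> \<Gamma> \<sigma>)
  then show ?case by (simp add: eq_sub_def comp_sub_id_right)
next
  case (4 \<Theta> \<Delta> \<Gamma> \<sigma> \<tau> A)
  then have "display \<Delta> \<Gamma> \<sigma>" "display \<Theta> \<Delta> \<tau>" "is_inst \<Gamma> A" by auto
  then show ?case
    unfolding eq_type_def by (metis inst_sub_comp inst_sub_is_inst)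
next
  case (5 \<Gamma> A)
  then show ?case by (simp add: eq_type_def inst_sub_id)
next
  case (6 \<Theta> \<Delta> \<Gamma> \<sigma> \<tau> A a)
  then have "display \<Delta> \<Gamma> \<sigma>" "display \<Theta> \<Delta> \<tau>" "is_trm \<Gamma> A a" by auto
  then show ?case
    unfolding eq_trm_def by (metis trm_sub_comp trm_sub_is_trm)
next
  case (7 \<Gamma> A a)
  then show ?case by (auto simp: eq_trm_def trm_sub_id[of \<Gamma> A a])
next
  case (8 \<Gamma> A a)
  then have "is_trm \<Gamma> A a" by auto
  then show ?case
    using display_id[OF inst_schema[OF trm_inst]] by (simp add: eq_sub_def down_hat)
next
  case (9 \<Gamma> A a)
  then show ?case by (simp add: eq_trm_def var_hat)
next
  case (10 \<Delta> \<Gamma> \<sigma> A)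
  then have f: "display \<Delta> \<Gamma> \<sigma>" and A: "is_inst \<Gamma> A" by auto
  show ?case
    using display_comp[OF display_down[OF inst_sub_is_inst[OF f A]] f]
    by (simp add: eq_sub_def down_tilde[OF f A])
next
  case (11 \<Delta> \<Gamma> \<sigma> A)
  then have f: "display \<Delta> \<Gamma> \<sigma>" and A: "is_inst \<Gamma> A" by auto
  show ?case
    using var_is_trm[OF inst_sub_is_inst[OF f A]] by (simp add: eq_trm_def var_tilde[OF f A])
next
  case (12 \<Delta> \<Gamma> \<sigma> A a)
  then have f: "display \<Delta> \<Gamma> \<sigma>" and a: "is_trm \<Gamma> A a" by auto
  show ?case
    using display_comp[OF f display_hat[OF a]] by (simp add: eq_sub_def tilde_hat[OF f a])
next
  case (13 \<Theta> \<Delta> \<Gamma> \<sigma> \<tau> A)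
  then have g: "display \<Delta> \<Gamma> \<sigma>" and f: "display \<Theta> \<Delta> \<tau>" and A: "is_inst \<Gamma> A" by auto
  show ?case
    using display_tilde[OF display_comp[OF f g] A] by (simp add: eq_sub_def tilde_comp[OF g f A])
next
  case (14 \<Gamma> A)
  then show ?case
    using display_id[OF elts_schema[of \<Gamma> A]] by (simp add: eq_sub_def tilde_var)
next
  case (15 \<Delta> \<Gamma> \<sigma> A B)
  then have f: "display \<Delta> \<Gamma> \<sigma>" and A: "is_inst \<Gamma> A" and B: "is_inst (elts \<Gamma> A) B" by auto
  show ?case
    using inst_sub_is_inst[OF f Pi_is_inst[OF A B]] by (simp add: eq_type_def Pi_inst_sub[OF f A B])
next
  case (16 \<Gamma> A B b)
  then show ?case by (simp add: eq_trm_def app_lam)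
next
  case (17 \<Gamma> A B C c0)
  note A = conjunct1[OF 17] and B = conjunct1[OF conjunct2[OF 17]]
    and c = conjunct2[OF conjunct2[OF conjunct2[OF 17]]]
  show ?case by (rule eq_trmI[OF c Sigma_computation[OF A B c]])
next
  case (18 \<Gamma> A C c0)
  note A = conjunct1[OF 18] and c = conjunct2[OF conjunct2[OF 18]]
  show ?case by (rule eq_trmI[OF c Id_computation[OF A c]])
next
  \<comment> \<open>the rule for binary sums is a conjunction and gives two goals\<close>
  case (19 \<Gamma> A B C c0 c1)
  note A = conjunct1[OF 19] and B = conjunct1[OF conjunct2[OF 19]]
    and c = conjunct1[OF conjunct2[OF conjunct2[OF conjunct2[OF 19]]]]
  show ?case by (rule eq_trmI[OF c Plus_computation_left[OF A B c]])
next
  case (20 \<Gamma> A B C c0 c1)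
  note A = conjunct1[OF 20] and B = conjunct1[OF conjunct2[OF 20]]
    and c = conjunct2[OF conjunct2[OF conjunct2[OF conjunct2[OF 20]]]]
  show ?case by (rule eq_trmI[OF c Plus_computation_right[OF A B c]])
next
  case (21 n i j)
  then show ?case
    using display_comp[OF display_face[of n i] display_face[of "Suc n" j]]
    by (simp add: eq_sub_def face_face)
qed

end
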